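(* Let $\mathcal X=\{x\in\mathbb R_+^n:Ax=b\}$ be a polyhedral domain ($A\in\mathbb R^{m\times n}$, $b\in\mathbb R^m$) admitting a point with all coordinates positive, and let $x^*\in\mathcal X$ be a solution of the variational inequality: $\langle g(x^* ),x-x^*\rangle\ge0$ for all $x\in\mathcal X$, with active set $\mathcal A$, slackness coefficients $(\nu_i)_{i\in\mathcal A}$, sharp directions $\mathcal A_\sharp$, flat directions $\mathcal A_\flat$, and sharpness $\nu^*=\min_{i\in\mathcal A_\sharp}\nu_i$ (defined in the context). Assume: (1) $g:\mathcal X\to\mathbb R^n$ satisfies $\|g(x')-g(x)\|_*\le L\|x'-x\|$ for all $x,x'\in\mathcal X$; (2) there are a convex neighborhood $\mathcal B$ of $x^*$ in $\mathcal X$ and $\mu>0$ with $\langle g(x)-g(x^* ),x-x^*\rangle\ge\mu\|x-x^*\|^2$ for all $x\in\mathcal B$; (3) $h$ is a Bregman regularizer on $\mathcal X$, decomposable with kernel $\theta$, tight at $x^*$ with Legendre exponent $\beta_h(x^* )\in[0,1)$, and $1$-strongly convex on a neighborhood of $x^*$ in $\mathcal X$; (4) $\theta$ satisfies one of the conditions (a) Euclidean-like, (b) entropy-like, (c) power-like with exponent $p\in(0,1)$ (defined in the context); (5) the sequences $x_t,x_{t+1/2}$ are generated by the Bregman proximal method (BPM) with parameters $\lambda_a,\lambda_b$ and constant step-size $\gamma_t\equiv\gamma>0$ such that $\gamma\le\frac1{2\varphi L}$ and $\gamma(1-\lambda_a-\lambda_b)^2\le\frac{\mu}{8L^2}$,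 where $\varphi=\frac{\sqrt5+1}2$, and $x_1$ is initialized sufficiently close to $x^*$. Then there is a constant $\varrho=\varrho(A,b,x^* )\ge1$, depending only on $\mathcal X$ (through $A,b$) and $x^*$, such that, setting $$\nu_{\mathrm{eff}}=\begin{cases}\nu^*&\text{if } \mathcal A_\flat=\varnothing\ (\text{i.e., } g\text{ is sharp at }x^* ),\\ \nu^*/\varrho&\text{otherwise},\end{cases}$$ we have for every $i\in\mathcal A_\sharp$ (with $x_{i,t}$ the $i$-th coordinate of $x_t$): (a) in the Euclidean-like case, there exists $T\ge1$ such that $x_{i,t}=0$ for all $t\ge T$; (b) in the entropy-like case, $x_{i,t}=O\big(\exp(-\gamma\nu_{\mathrm{eff}}t/2)\big)$ as $t\to\infty$; (c) in the power-like case with exponent $p$, $x_{i,t}=O\big((\gamma\nu_{\mathrm{eff}}t/2)^{-1/p}\big)$ as $t\to\infty$. ("Sufficiently close" means: there is a neighborhood $\mathcal U_1$ of $x^*$ in $\mathcal X$ such that the conclusions hold whenever $x_1\in\mathcal U_1\cap\mathcal X_h$.)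
   Context: Setting. $\mathbb R^n$ carries the Euclidean pairing $\langle\cdot,\cdot\rangle$ (primal and dual vectors are identified), a norm $\|\cdot\|$ and its dual norm $\|y\|_*=\max\{\langle y,x\rangle:\|x\|\le1\}$. $e_1,\dots,e_n$ is the standard basis, $\operatorname{row}(A)=(\ker A)^\perp$. Sharp and flat directions. $\mathcal A=\{i:x^*_i=0\}$. Since $x^*$ solves the variational inequality, there are coefficients $\nu_i\ge0$, $i\in\mathcal A$ (slackness coefficients), with $g(x^* )-\sum_{i\in\mathcal A}\nu_ie_i\in\operatorname{row}(A)$; fix such coefficients. $\mathcal A_\sharp=\{i\in\mathcal A:\nu_i>0\}$, $\mathcal A_\flat=\{i\in\mathcal A:\nu_i=0\}$; $g$ is sharp at $x^*$ if $\mathcal A_\sharp=\mathcal A$. Bregman regularizer on $\mathcal X$: a proper, lower semicontinuous, strictly convex $h:\mathbb R^n\to\mathbb R\cup\{\infty\}$ such that (i) $\operatorname{dom}h=\mathcal X$; (ii) there is a continuous map $\nabla h:\operatorname{dom}\partial h\to\mathbb R^n$ with $\nabla h(x)\in\partial h(x)$ for all $x\in\operatorname{dom}\partial h$; (iii) for every compact $\mathcal K\subseteq\operatorname{dom}h$ there is $\kappa>0$ with $h(x')\ge h(x)+\langle\nabla h(x),x'-x\rangle+\frac\kappa2\|x'-x\|^2$ for all $x\in\mathcal K\cap\operatorname{dom}\partial h$, $x'\in\mathcal K$. "$1$-strongly convex on $\mathcal U$" means this inequality holds with $\kappa=1$ for all $x\in\mathcal U\cap\operatorname{dom}\partial h$,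 $x'\in\mathcal U$. Prox-domain: $\mathcal X_h=\operatorname{dom}\partial h$. Bregman divergence: $D(p,x)=h(p)-h(x)-\langle\nabla h(x),p-x\rangle$ ($p\in\mathcal X$, $x\in\mathcal X_h$). Prox-mapping: $P_x(y)=\arg\min_{x'\in\mathcal X}\{\langle y,x-x'\rangle+D(x',x)\}$ ($x\in\mathcal X_h$, $y\in\mathbb R^n$), assumed well-defined whenever invoked. Legendre exponent: $\beta_h(p)=\inf\{\beta\in[0,1]:\limsup_{x\to p}\sqrt{D(p,x)}/\|x-p\|^{1-\beta}<\infty\}$ (limit over $x\in\mathcal X_h$); $h$ is tight at $p$ if the infimum is attained. Decomposable with kernel $\theta$: $h(x)=\sum_{i=1}^n\theta(x_i)$ for all $x\in\mathcal X$, where $\theta:\mathbb R_+\to\mathbb R$ is continuous, $\theta''(z)>0$ for all $z>0$, and $\theta''$ is locally Lipschitz on $(0,\infty)$. In this case the continuous selection used is $\nabla h(x)=\sum_i\theta'(x_i)e_i$ on $\mathcal X_h=\{x\in\mathcal X: x_i\in\operatorname{dom}\partial\theta\ \forall i\}$. Kernel conditions: (a) Euclidean-like: $\liminf_{x\to0^+}\theta'(x)>-\infty$; (b) entropy-like: $\liminf_{x\to0^+}[\theta'(x)-\log x]>-\infty$; (c) power-like: $\liminf_{x\to0^+}x^p\theta'(x)>-\infty$ for some $p\in(0,1)$. Convention: since (a)$\Rightarrow$(b)$\Rightarrow$(c), when (b) is assumed it is understood that (a) does not hold, and when (c) is assumed it is understood that (a) and (b) do not hold. (BPM): with $x_{1/2}=x_1\in\mathcal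 X_h$ and for $t=1,2,\dots$, $$x_{t+1/2}=P_{x_t}(-\gamma_tg_t),\qquad x_{t+1}=P_{x_t}(-\gamma_tg_{t+1/2}),$$ where $g_{t+1/2}=g(x_{t+1/2})$ and $g_t=\lambda_ag(x_t)+\lambda_bg(x_{t-1/2})$, for fixed $\lambda_a,\lambda_b\in[0,1]$ with $\lambda_a+\lambda_b\le1$, and $\lambda_a+\lambda_b=1$ if $\lambda_b>0$. *)

theory Defs
  imports "HOL-Analysis.Analysis" "HOL-Library.Landau_Symbols"
begin

definition is_norm :: "(real^'n \<Rightarrow> real) \<Rightarrow> bool" where
  "is_norm N \<longleftrightarrow>
     (\<forall>x. N x = 0 \<longleftrightarrow> x = 0) \<and>
     (\<forall>c x. N (c *\<^sub>R x) = \<bar>c\<bar> * N x) \<and>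
     (\<forall>x y. N (x + y) \<le> N x + N y)"

text \<open>For a norm the supremum is over a compact set, hence it is a maximum.\<close>

definition dual_norm :: "(real^'n \<Rightarrow> real) \<Rightarrow> real^'n \<Rightarrow> real" where
  "dual_norm N y = Sup {y \<bullet> x | x. N x \<le> 1}"

definition feasible :: "real^'n^'m \<Rightarrow> real^'m \<Rightarrow> (real^'n) set" where
  "feasible A b = {x. (\<forall>i. 0 \<le> x $ i) \<and> A *v x = b}"

definition row_sp :: "real^'n^'m \<Rightarrow> (real^'n) set" where
  "row_sp A = orthogonal_comp {z. A *v z = 0}"

definition nhd_in :: "'a::topological_space set \<Rightarrow> 'a \<Rightarrow> 'a set \<Rightarrow> bool" where
  "nhd_in X p U \<longleftrightarrow> U \<subseteq> X \<and> (\<exists>V. open V \<and> p \<in> V \<and> V \<inter> X \<subseteq> U)"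

definition solves_VI :: "(real^'n) set \<Rightarrow> (real^'n \<Rightarrow> real^'n) \<Rightarrow> real^'n \<Rightarrow> bool" where
  "solves_VI X g p \<longleftrightarrow> p \<in> X \<and> (\<forall>x\<in>X. 0 \<le> g p \<bullet> (x - p))"

definition active :: "real^'n \<Rightarrow> 'n set" where
  "active p = {i. p $ i = 0}"

definition slackness ::
  "real^'n^'m \<Rightarrow> (real^'n \<Rightarrow> real^'n) \<Rightarrow> real^'n \<Rightarrow> ('n \<Rightarrow> real) \<Rightarrow> bool" where
  "slackness A g p \<nu> \<longleftrightarrow>
     (\<forall>i\<in>active p. 0 \<le> \<nu> i) \<and>
     g p - (\<Sum>i\<in>active p. \<nu> i *\<^sub>R axis i 1) \<in> row_sp A"

definition sharp_dirs :: "real^'n \<Rightarrow> ('n \<Rightarrow> real) \<Rightarrow> 'n set" where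
  "sharp_dirs p \<nu> = {i \<in> active p. 0 < \<nu> i}"

definition flat_dirs :: "real^'n \<Rightarrow> ('n \<Rightarrow> real) \<Rightarrow> 'n set" where
  "flat_dirs p \<nu> = {i \<in> active p. \<nu> i = 0}"

text \<open>The value is irrelevant when there are no sharp directions.\<close>

definition sharpness :: "real^'n \<Rightarrow> ('n \<Rightarrow> real) \<Rightarrow> real" where
  "sharpness p \<nu> = Min (\<nu> ` sharp_dirs p \<nu>)"

definition eff_sharpness :: "real^'n \<Rightarrow> ('n \<Rightarrow> real) \<Rightarrow> real \<Rightarrow> real" where
  "eff_sharpness p \<nu> \<rho> =
     (if flat_dirs p \<nu> = {} then sharpness p \<nu> else sharpness p \<nu> / \<rho>)"

definition eff_dom :: "('a \<Rightarrow> ereal) \<Rightarrow> 'a set" where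
  "eff_dom h = {x. h x < \<infinity>}"

definition proper_fun :: "('a \<Rightarrow> ereal) \<Rightarrow> bool" where
  "proper_fun h \<longleftrightarrow> (\<forall>x. h x \<noteq> -\<infinity>) \<and> eff_dom h \<noteq> {}"

definition lower_semicont :: "('a::topological_space \<Rightarrow> ereal) \<Rightarrow> bool" where
  "lower_semicont h \<longleftrightarrow> (\<forall>x. h x \<le> Liminf (at x) h)"

definition strictly_convex_fun :: "('a::real_vector \<Rightarrow> ereal) \<Rightarrow> bool" where
  "strictly_convex_fun h \<longleftrightarrow>
     (\<forall>x\<in>eff_dom h. \<forall>y\<in>eff_dom h. \<forall>u\<in>{0<..<1}. x \<noteq> y \<longrightarrow>
        h ((1 - u) *\<^sub>R x + u *\<^sub>R y) < ereal (1 - u) * h x + ereal u * h y)"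

definition subdiff :: "('a::real_inner \<Rightarrow> ereal) \<Rightarrow> 'a \<Rightarrow> 'a set" where
  "subdiff h x = {v. \<bar>h x\<bar> \<noteq> \<infinity> \<and> (\<forall>x'. h x + ereal (v \<bullet> (x' - x)) \<le> h x')}"

definition prox_dom :: "('a::real_inner \<Rightarrow> ereal) \<Rightarrow> 'a set" where
  "prox_dom h = {x. subdiff h x \<noteq> {}}"

text \<open>Throughout, \<open>dh\<close> is the chosen selection of subgradients of \<open>h\<close> on \<open>prox_dom h\<close>.\<close>

definition strongly_convex_wrt ::
  "(real^'n \<Rightarrow> real) \<Rightarrow> real \<Rightarrow> (real^'n \<Rightarrow> ereal) \<Rightarrow> (real^'n \<Rightarrow> real^'n) \<Rightarrow> (real^'n) set \<Rightarrow> bool" where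
  "strongly_convex_wrt N \<kappa> h dh U \<longleftrightarrow>
     (\<forall>x\<in>U \<inter> prox_dom h. \<forall>x'\<in>U.
        h x + ereal (dh x \<bullet> (x' - x) + \<kappa> / 2 * (N (x' - x))\<^sup>2) \<le> h x')"

definition bregman_regularizer ::
  "(real^'n \<Rightarrow> real) \<Rightarrow> (real^'n) set \<Rightarrow> (real^'n \<Rightarrow> ereal) \<Rightarrow> (real^'n \<Rightarrow> real^'n) \<Rightarrow> bool" where
  "bregman_regularizer N X h dh \<longleftrightarrow>
     proper_fun h \<and> lower_semicont h \<and> strictly_convex_fun h \<and>
     eff_dom h = X \<and>
     continuous_on (prox_dom h) dh \<and> (\<forall>x\<in>prox_dom h. dh x \<in> subdiff h x) \<and>
     (\<forall>K. compact K \<and> K \<subseteq> eff_dom h \<longrightarrow> (\<exists>\<kappa>>0. strongly_convex_wrt N \<kappa> h dh K))"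

text \<open>Only used at points \<open>p\<close>, \<open>x\<close> where \<open>h\<close> is finite.\<close>

definition bregman_div ::
  "(real^'n \<Rightarrow> ereal) \<Rightarrow> (real^'n \<Rightarrow> real^'n) \<Rightarrow> real^'n \<Rightarrow> real^'n \<Rightarrow> real" where
  "bregman_div h dh p x = real_of_ereal (h p) - real_of_ereal (h x) - dh x \<bullet> (p - x)"

definition legendre_set ::
  "(real^'n \<Rightarrow> real) \<Rightarrow> (real^'n \<Rightarrow> ereal) \<Rightarrow> (real^'n \<Rightarrow> real^'n) \<Rightarrow> real^'n \<Rightarrow> real set" where
  "legendre_set N h dh p =
     {\<beta> \<in> {0..1}.
        Limsup (at p within prox_dom h)
          (\<lambda>x. ereal (sqrt (bregman_div h dh p x) / N (x - p) powr (1 - \<beta>))) < \<infinity>}"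

definition legendre_exponent ::
  "(real^'n \<Rightarrow> real) \<Rightarrow> (real^'n \<Rightarrow> ereal) \<Rightarrow> (real^'n \<Rightarrow> real^'n) \<Rightarrow> real^'n \<Rightarrow> real" where
  "legendre_exponent N h dh p = Inf (legendre_set N h dh p)"

definition tight_at ::
  "(real^'n \<Rightarrow> real) \<Rightarrow> (real^'n \<Rightarrow> ereal) \<Rightarrow> (real^'n \<Rightarrow> real^'n) \<Rightarrow> real^'n \<Rightarrow> bool" where
  "tight_at N h dh p \<longleftrightarrow> legendre_exponent N h dh p \<in> legendre_set N h dh p"

definition kernel :: "(real \<Rightarrow> real) \<Rightarrow> bool" where
  "kernel \<theta> \<longleftrightarrow>
     continuous_on {0..} \<theta> \<and>
     (\<forall>z>0. \<theta> differentiable (at z) \<and> deriv \<theta> differentiable (at z) \<and> 0 < deriv (deriv \<theta>) z) \<and>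
     (\<forall>z>0. \<exists>\<epsilon>>0. \<exists>C. C-lipschitz_on (ball z \<epsilon> \<inter> {0<..}) (deriv (deriv \<theta>)))"

text \<open>
  The derivative within the half-line is the ordinary one at positive points and the right
  derivative at \<open>0\<close>. The latter exists iff \<open>0\<close> is in the domain of the subdifferential of
  \<open>\<theta>\<close>; if the domain of \<open>h\<close> has a point with positive coordinates, this is the case
  as soon as some coordinate of a point of \<open>prox_dom h\<close> vanishes.
\<close>

definition kernel_grad :: "(real \<Rightarrow> real) \<Rightarrow> real^'n \<Rightarrow> real^'n" where
  "kernel_grad \<theta> x = (\<chi> i. vector_derivative \<theta> (at (x $ i) within {0..}))"

definition decomposable ::
  "(real^'n) set \<Rightarrow> (real^'n \<Rightarrow> ereal) \<Rightarrow> (real^'n \<Rightarrow> real^'n) \<Rightarrow> (real \<Rightarrow> real) \<Rightarrow> bool" where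
  "decomposable X h dh \<theta> \<longleftrightarrow>
     kernel \<theta> \<and>
     (\<forall>x\<in>X. h x = ereal (\<Sum>i\<in>UNIV. \<theta> (x $ i))) \<and>
     (\<forall>x\<in>prox_dom h. dh x = kernel_grad \<theta> x)"

text \<open>
  The three growth conditions weaken successively; each of the last two is understood to exclude
  the preceding ones.
\<close>

definition euclidean_like :: "(real \<Rightarrow> real) \<Rightarrow> bool" where
  "euclidean_like \<theta> \<longleftrightarrow> Liminf (at_right 0) (\<lambda>x. ereal (deriv \<theta> x)) > -\<infinity>"

definition entropy_like :: "(real \<Rightarrow> real) \<Rightarrow> bool" where
  "entropy_like \<theta> \<longleftrightarrow>
     Liminf (at_right 0) (\<lambda>x. ereal (deriv \<theta> x - ln x)) > -\<infinity> \<and> \<not> euclidean_like \<theta>"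

definition power_like :: "real \<Rightarrow> (real \<Rightarrow> real) \<Rightarrow> bool" where
  "power_like p \<theta> \<longleftrightarrow>
     0 < p \<and> p < 1 \<and>
     Liminf (at_right 0) (\<lambda>x. ereal (x powr p * deriv \<theta> x)) > -\<infinity> \<and>
     \<not> euclidean_like \<theta> \<and> \<not> entropy_like \<theta>"

definition prox_obj ::
  "(real^'n \<Rightarrow> ereal) \<Rightarrow> (real^'n \<Rightarrow> real^'n) \<Rightarrow> real^'n \<Rightarrow> real^'n \<Rightarrow> real^'n \<Rightarrow> real" where
  "prox_obj h dh x y x' = y \<bullet> (x - x') + bregman_div h dh x' x"

definition prox ::
  "(real^'n) set \<Rightarrow> (real^'n \<Rightarrow> ereal) \<Rightarrow> (real^'n \<Rightarrow> real^'n) \<Rightarrow> real^'n \<Rightarrow> real^'n \<Rightarrow> real^'n" where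
  "prox X h dh x y = arg_min (prox_obj h dh x y) (\<lambda>x'. x' \<in> X)"

definition prox_defined ::
  "(real^'n) set \<Rightarrow> (real^'n \<Rightarrow> ereal) \<Rightarrow> (real^'n \<Rightarrow> real^'n) \<Rightarrow> real^'n \<Rightarrow> real^'n \<Rightarrow> bool" where
  "prox_defined X h dh x y \<longleftrightarrow> (\<exists>!z. is_arg_min (prox_obj h dh x y) (\<lambda>x'. x' \<in> X) z)"

definition bpm_params :: "real \<Rightarrow> real \<Rightarrow> bool" where
  "bpm_params la lb \<longleftrightarrow>
     la \<in> {0..1} \<and> lb \<in> {0..1} \<and> la + lb \<le> 1 \<and> (0 < lb \<longrightarrow> la + lb = 1)"

text \<open>
  \<open>x t\<close> is the iterate at time \<open>t\<close> (for \<open>t \<ge> 1\<close>; \<open>x 0\<close> is junk) and \<open>xh t\<close> the one at time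
  \<open>t + 1/2\<close> (for \<open>t \<ge> 0\<close>).
\<close>

definition bpm ::
  "(real^'n) set \<Rightarrow> (real^'n \<Rightarrow> ereal) \<Rightarrow> (real^'n \<Rightarrow> real^'n) \<Rightarrow> (real^'n \<Rightarrow> real^'n) \<Rightarrow>
   real \<Rightarrow> real \<Rightarrow> (nat \<Rightarrow> real) \<Rightarrow> (nat \<Rightarrow> real^'n) \<Rightarrow> (nat \<Rightarrow> real^'n) \<Rightarrow> bool" where
  "bpm X h dh g la lb \<gamma> x xh \<longleftrightarrow>
     x 1 \<in> prox_dom h \<and> xh 0 = x 1 \<and>
     (\<forall>t\<ge>1.
        let y  = - \<gamma> t *\<^sub>R (la *\<^sub>R g (x t) + lb *\<^sub>R g (xh (t - 1)));
            y' = - \<gamma> t *\<^sub>R g (xh t)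
        in prox_defined X h dh (x t) y \<and> xh t = prox X h dh (x t) y \<and>
           prox_defined X h dh (x t) y' \<and> x (t + 1) = prox X h dh (x t) y')"

end

theory Submission
  imports Defs
begin

text \<open>
  Three-point inequalities for the two prox steps, decomposed around \<open>g xs\<close>, make
  \<open>D(xs, x_t) + \<kappa>/2 * N(x_t - x_{t-1/2})^2\<close> with \<open>\<kappa> = \<gamma> L\<close> a Lyapunov function. Tightness makes its
  initial value small, so the iterates never leave the region of strong convexity and converge.

  For the rates, let \<open>S\<close> be the sum of the sharp coordinates of \<open>x_t\<close>. A vertex argument gives a
  feasible \<open>y\<close> with vanishing sharp coordinates and \<open>norm (x_t - y) \<le> H S\<close>. In the Euclidean-like
  case one step of optimality tested against \<open>x_t - y\<close> yields \<open>\<nu>* S \<le> o(1) S\<close>, hence \<open>S = 0\<close>. Otherwise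
  the iterates are positive, the optimality conditions are equalities on the kernel of \<open>A\<close> and
  telescope, and testing with \<open>x_t - y\<close> gives
  \<open>\<Sum>i w_i \<theta>'(w_i) \<le> (C - \<gamma> \<nu>* t/2) S\<close> with weights \<open>w_i\<close> that add up to \<open>S\<close> over the sharp and to at
  most \<open>n H S\<close> over the flat coordinates. Inserting the lower bound on \<open>\<theta>'\<close> gives the rates; the
  flat weights are the origin of \<open>\<rho> = 1 + n H\<close>.
\<close>

section \<open>Norms\<close>

lemma is_normD:
  assumes "is_norm N"
  shows "N 0 = 0" "N (- x) = N x" "N (x - y) = N (y - x)" "N (c *\<^sub>R x) = \<bar>c\<bar> * N x"
    "N (x + y) \<le> N x + N y" "0 \<le> N x" "N x = 0 \<longleftrightarrow> x = 0"
proof -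
  note D = assms[unfolded is_norm_def]
  show 0: "N 0 = 0" using D by simp
  show sc: "N (c *\<^sub>R x) = \<bar>c\<bar> * N x" for c x using D by blast
  show m: "N (- x) = N x" for x using sc[of "-1" x] by simp
  show "N (x - y) = N (y - x)" using m[of "x - y"] by simp
  show tr: "N (x + y) \<le> N x + N y" for x y using D by blast
  show "0 \<le> N x" using tr[of x "- x"] m[of x] 0 by simp
  show "N x = 0 \<longleftrightarrow> x = 0" using D by blast
qed

lemma is_norm_triangle:
  assumes "is_norm N" shows "N (x - z) \<le> N (x - y) + N (y - z)"
  using is_normD(5)[OF assms, of "x - y" "y - z"] by simp

text \<open>Expand in the standard basis; each coordinate is at most the Euclidean norm.\<close>

lemma is_norm_upper:
  fixes N :: "real^'n \<Rightarrow> real"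
  assumes "is_norm N"
  obtains C where "C > 0" "\<And>x. N x \<le> C * norm x"
proof -
  define C where "C = (\<Sum>b\<in>Basis. N b) + 1"
  have sum_le: "N (sum f S) \<le> (\<Sum>b\<in>S. N (f b))" if "finite S" for f and S :: "(real^'n) set"
    using that
  proof (induction S rule: finite_induct)
    case empty then show ?case using is_normD(1)[OF assms] by simp
  next
    case (insert b S)
    then show ?case using is_normD(5)[OF assms, of "f b" "sum f S"] by simp
  qed
  have "N x \<le> C * norm x" for x
  proof -
    have "N x = N (\<Sum>b\<in>Basis. (x \<bullet> b) *\<^sub>R b)" by (simp add: euclidean_representation)
    also have "\<dots> \<le> (\<Sum>b\<in>Basis. N ((x \<bullet> b) *\<^sub>R b))" by (intro sum_le) simp
    also have "\<dots> \<le> (\<Sum>b\<in>Basis. norm x * N b)"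
      by (intro sum_mono)
        (simp add: is_normD(4)[OF assms] Basis_le_norm mult_right_mono is_normD(6)[OF assms])
    also have "\<dots> \<le> C * norm x"
      by (simp add: C_def sum_distrib_left algebra_simps)
    finally show ?thesis .
  qed
  moreover have "C > 0"
    unfolding C_def by (intro add_nonneg_pos sum_nonneg is_normD(6)[OF assms]) auto
  ultimately show ?thesis using that by blast
qed

text \<open>The upper bound makes \<open>N\<close> Lipschitz, so it attains its infimum on the
  compact Euclidean unit sphere. Definiteness makes this minimum positive, and homogeneity spreads
  it to all vectors.\<close>

lemma is_norm_lower:
  fixes N :: "real^'n \<Rightarrow> real"
  assumes "is_norm N"
  obtains c where "c > 0" "\<And>x. c * norm x \<le> N x"
proof -
  obtain C where C: "C > 0" "\<And>x. N x \<le> C * norm x" using is_norm_upper[OF assms] by blast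
  have "C-lipschitz_on UNIV N"
  proof (rule lipschitz_onI)
    fix x y
    have "\<bar>N x - N y\<bar> \<le> N (x - y)"
      using is_norm_triangle[OF assms, of x 0 y] is_norm_triangle[OF assms, of y 0 x]
        is_normD(3)[OF assms, of x y] by simp
    also have "\<dots> \<le> C * norm (x - y)" by (rule C)
    finally show "dist (N x) (N y) \<le> C * dist x y" by (simp add: dist_norm)
  qed (use C in auto)
  then have "continuous_on (sphere 0 1) N"
    by (meson continuous_on_subset lipschitz_on_continuous_on subset_UNIV)
  moreover have "sphere (0::real^'n) 1 \<noteq> {}" by simp
  ultimately obtain u where u: "u \<in> sphere 0 1" "\<And>x. x \<in> sphere 0 1 \<Longrightarrow> N u \<le> N x"
    using continuous_attains_inf[of "sphere 0 1" N] by auto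
  have "N u * norm x \<le> N x" for x
  proof (cases "x = 0")
    case True then show ?thesis using is_normD(1)[OF assms] by simp
  next
    case False
    then have "N u \<le> N ((1 / norm x) *\<^sub>R x)" by (intro u) simp
    then show ?thesis using False by (simp only: is_normD(4)[OF assms]) (simp add: field_simps)
  qed
  moreover have "N u > 0"
    using u(1) is_normD(6)[OF assms, of u] is_normD(7)[OF assms, of u] by fastforce
  ultimately show ?thesis using that by blast
qed

text \<open>Normalise \<open>x\<close> and compare with the supremum. The work lies in boundedness
  of the set, without which \<open>Sup\<close> on the reals says nothing; it comes from
  \<open>is_norm_lower\<close>.\<close>

lemma inner_le_dual_norm:
  fixes N :: "real^'n \<Rightarrow> real"
  assumes "is_norm N"
  shows "y \<bullet> x \<le> dual_norm N y * N x"
proof (cases "x = 0")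
  case True then show ?thesis using is_normD(1)[OF assms] by simp
next
  case False
  then have pos: "N x > 0" using is_normD(6,7)[OF assms, of x] by simp
  obtain c where c: "c > 0" "\<And>x. c * norm x \<le> N x" using is_norm_lower[OF assms] by blast
  have "bdd_above {y \<bullet> x | x. N x \<le> 1}"
  proof (rule bdd_aboveI)
    fix r assume "r \<in> {y \<bullet> x | x. N x \<le> 1}"
    then obtain x where x: "r = y \<bullet> x" "N x \<le> 1" by blast
    have "norm x \<le> 1 / c" using c(1) c(2)[of x] x(2) by (simp add: field_simps)
    then have "norm y * norm x \<le> norm y * (1 / c)" by (simp only: mult_left_mono norm_ge_zero)
    then show "r \<le> norm y * (1 / c)"
      using norm_cauchy_schwarz[of y x] x(1) by linarith
  qed
  moreover have "N ((1 / N x) *\<^sub>R x) \<le> 1" using pos by (simp add: is_normD(4)[OF assms])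
  ultimately have "y \<bullet> ((1 / N x) *\<^sub>R x) \<le> dual_norm N y"
    unfolding dual_norm_def by (intro cSup_upper) blast+
  then show ?thesis using pos by (simp add: field_simps)
qed

section \<open>Kernels\<close>

lemma kernel_DERIV:
  assumes "kernel \<theta>" "0 < z"
  shows "(\<theta> has_real_derivative deriv \<theta> z) (at z)"
  using assms unfolding kernel_def
  by (metis DERIV_deriv_iff_real_differentiable)

lemma kernel_deriv_mono:
  assumes "kernel \<theta>" "0 < a" "a \<le> b"
  shows "deriv \<theta> a \<le> deriv \<theta> b"
proof (rule DERIV_nonneg_imp_nondecreasing[OF assms(3)])
  fix x assume "a \<le> x" "x \<le> b"
  then have "0 < x" using assms by simp
  then show "\<exists>y. (deriv \<theta> has_real_derivative y) (at x) \<and> 0 \<le> y"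
    using assms(1) unfolding kernel_def
    by (metis DERIV_deriv_iff_real_differentiable less_imp_le)
qed

lemma kernel_MVT:
  assumes "kernel \<theta>" "0 \<le> a" "a < b"
  obtains z where "a < z" "z < b" "\<theta> b - \<theta> a = (b - a) * deriv \<theta> z"
proof -
  have "continuous_on {a..b} \<theta>"
    using assms unfolding kernel_def by (auto elim: continuous_on_subset)
  moreover have "\<theta> differentiable (at x)" if "a < x" for x
    using assms that unfolding kernel_def by simp
  ultimately obtain l z where z: "a < z" "z < b" "(\<theta> has_real_derivative l) (at z)"
    "\<theta> b - \<theta> a = (b - a) * l"
    using MVT[OF assms(3), of \<theta>] by blast
  moreover from z have "l = deriv \<theta> z" by (simp add: DERIV_imp_deriv)
  ultimately show ?thesis using that by blast
qed

lemma kernel_tangent: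
  assumes "kernel \<theta>" "0 \<le> a" "0 < b"
  shows "\<theta> b - \<theta> a \<le> (b - a) * deriv \<theta> b"
proof -
  consider "a < b" | "a = b" | "b < a" by linarith
  then show ?thesis
  proof cases
    case 1
    then obtain z where z: "a < z" "z < b" "\<theta> b - \<theta> a = (b - a) * deriv \<theta> z"
      using kernel_MVT[OF assms(1,2)] by blast
    moreover have "deriv \<theta> z \<le> deriv \<theta> b" using z assms by (intro kernel_deriv_mono) auto
    ultimately show ?thesis using 1 by (simp add: mult_left_mono)
  next
    case 3
    then obtain z where z: "b < z" "z < a" "\<theta> a - \<theta> b = (a - b) * deriv \<theta> z"
      using kernel_MVT[OF assms(1), of b a] assms by auto
    moreover have "deriv \<theta> b \<le> deriv \<theta> z" using z assms by (intro kernel_deriv_mono) auto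
    ultimately have "(a - b) * deriv \<theta> b \<le> \<theta> a - \<theta> b" using 3 by (simp add: mult_left_mono)
    then show ?thesis by (simp add: algebra_simps)
  qed simp
qed

section \<open>Derivatives of kernels up to the boundary point \<open>0\<close>\<close>

abbreviation right_deriv :: "(real \<Rightarrow> real) \<Rightarrow> real \<Rightarrow> real" where
  "right_deriv \<theta> z \<equiv> vector_derivative \<theta> (at z within {0..})"

text \<open>\<open>vector_derivative\<close> is a choice among derivatives; it is determined here
  because every point of the half-line, \<open>0\<close> included, is a limit point of it.\<close>

lemma right_deriv_eqI:
  assumes "(\<theta> has_real_derivative l) (at z within {0..})" "0 \<le> z"
  shows "right_deriv \<theta> z = l"
proof -
  have "at z within {0..} \<noteq> bot"
    unfolding trivial_limit_within not_not
    by (rule islimpt_subset[OF islimpt_greaterThanLessThan1[of z "z + 1"]]) (use assms(2) in auto)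
  then show ?thesis
    using assms(1) by (intro vector_derivative_within) (auto simp: has_real_derivative_iff_has_vector_derivative)
qed

lemma kernel_right_deriv_pos:
  assumes "kernel \<theta>" "0 < z"
  shows "right_deriv \<theta> z = deriv \<theta> z"
  using kernel_DERIV[OF assms] assms(2)
  by (intro right_deriv_eqI) (auto intro: has_field_derivative_at_within)

text \<open>If \<theta>' stayed above \<open>M\<close>, so would its lower limit. One value below
  \<open>M\<close> then propagates to all smaller positive arguments by monotonicity.\<close>

lemma not_euclidean_like_deriv:
  assumes "kernel \<theta>" "\<not> euclidean_like \<theta>"
  obtains z where "0 < z" "\<And>u. 0 < u \<Longrightarrow> u \<le> z \<Longrightarrow> deriv \<theta> u < M"
proof -
  have "\<exists>z>0. deriv \<theta> z < M"
  proof (rule ccontr)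
    assume "\<not> (\<exists>z>0. deriv \<theta> z < M)"
    then have "eventually (\<lambda>z. ereal M \<le> ereal (deriv \<theta> z)) (at_right 0)"
      unfolding eventually_at_right_field by (intro exI[of _ 1]) (force simp: not_less)
    then have "ereal M \<le> Liminf (at_right 0) (\<lambda>z. ereal (deriv \<theta> z))"
      by (rule Liminf_bounded)
    then show False using assms(2) unfolding euclidean_like_def by auto
  qed
  then obtain z where z: "z > 0" "deriv \<theta> z < M" by blast
  moreover have "deriv \<theta> u < M" if "0 < u" "u \<le> z" for u
    using kernel_deriv_mono[OF assms(1) that] z by simp
  ultimately show ?thesis using that by blast
qed

lemma Liminf_at_right_0_lower:
  fixes f :: "real \<Rightarrow> real"
  assumes "- \<infinity> < Liminf (at_right 0) (\<lambda>x. ereal (f x))"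
  shows "\<exists>d>0. \<exists>M. \<forall>x. 0 < x \<longrightarrow> x < d \<longrightarrow> M \<le> f x"
proof -
  obtain M where "ereal M < Liminf (at_right 0) (\<lambda>x. ereal (f x))"
    using assms by (metis ereal_dense2)
  then have "eventually (\<lambda>x. ereal M < ereal (f x)) (at_right 0)"
    by (rule less_LiminfD)
  then obtain d where "0 < d" "\<And>x. 0 < x \<Longrightarrow> x < d \<Longrightarrow> M < f x"
    unfolding eventually_at_right_field by auto
  then show ?thesis by (meson less_imp_le)
qed

lemma euclidean_like_bound:
  assumes "kernel \<theta>" "euclidean_like \<theta>"
  obtains M where "\<And>z. 0 < z \<Longrightarrow> M \<le> deriv \<theta> z"
proof -
  obtain d M' where d: "d > 0" "\<And>x. 0 < x \<Longrightarrow> x < d \<Longrightarrow> M' \<le> deriv \<theta> x"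
    using Liminf_at_right_0_lower[of "deriv \<theta>"] assms(2) unfolding euclidean_like_def by auto
  have "M' \<le> deriv \<theta> z" if "0 < z" for z
    using d(2)[of "min z (d/2)"] kernel_deriv_mono[OF assms(1), of "min z (d/2)" z] that d(1)
    by fastforce
  then show ?thesis using that by blast
qed

text \<open>As its argument tends to \<open>0\<close>, \<theta>' decreases to its finite infimum
  \<open>l\<close>, and the mean value theorem identifies \<open>l\<close> as the right derivative
  at \<open>0\<close>. Hence the gradients of convergent iterates converge even if the limit lies on
  the boundary.\<close>

lemma euclidean_like_right_deriv:
  assumes "kernel \<theta>" "euclidean_like \<theta>"
  shows "(\<theta> has_real_derivative right_deriv \<theta> 0) (at 0 within {0..})"
    and "continuous_on {0..} (right_deriv \<theta>)"
proof -
  obtain M where M: "\<And>z. 0 < z \<Longrightarrow> M \<le> deriv \<theta> z" using euclidean_like_bound[OF assms] by blast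
  define l where "l = Inf (deriv \<theta> ` {0<..})"
  have bdd: "bdd_below (deriv \<theta> ` {0<..})" using M by (auto intro!: bdd_belowI)
  have l_le: "l \<le> deriv \<theta> z" if "0 < z" for z
    unfolding l_def using bdd that by (auto intro: cInf_lower)
  have near: "\<exists>d>0. \<forall>z. 0 < z \<longrightarrow> z < d \<longrightarrow> \<bar>deriv \<theta> z - l\<bar> < e" if "e > 0" for e
  proof -
    have "\<exists>y\<in>deriv \<theta> ` {0<..}. y < l + e"
      by (rule cInf_lessD) (use that in \<open>auto simp: l_def\<close>)
    then obtain y where y: "y \<in> deriv \<theta> ` {0<..}" "y < l + e" by blast
    then obtain d where d: "d > 0" "deriv \<theta> d < l + e" by auto
    have "\<bar>deriv \<theta> z - l\<bar> < e" if "0 < z" "z < d" for z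
      using l_le[OF that(1)] kernel_deriv_mono[OF assms(1) that(1), of d] that d by simp
    then show ?thesis using d by blast
  qed
  have D: "(\<theta> has_real_derivative l) (at 0 within {0..})"
    unfolding has_field_derivative_iff
  proof (rule Lim_withinI)
    fix e :: real assume "e > 0"
    then obtain d where d: "d > 0" "\<And>z. 0 < z \<Longrightarrow> z < d \<Longrightarrow> \<bar>deriv \<theta> z - l\<bar> < e"
      using near by blast
    have "dist ((\<theta> x - \<theta> 0) / (x - 0)) l \<le> e" if x: "x \<in> {0..}" "0 < dist x 0" "dist x 0 < d" for x
    proof -
      have "0 < x" "x < d" using x by auto
      then obtain z where "0 < z" "z < x" "\<theta> x - \<theta> 0 = (x - 0) * deriv \<theta> z"
        using kernel_MVT[OF assms(1), of 0 x] by auto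
      then show ?thesis using d(2)[of z] \<open>x < d\<close> \<open>0 < x\<close> by (simp add: dist_real_def)
    qed
    then show "\<exists>d>0. \<forall>x\<in>{0..}. 0 < dist x 0 \<and> dist x 0 < d \<longrightarrow>
        dist ((\<theta> x - \<theta> 0) / (x - 0)) l \<le> e" using d(1) by blast
  qed
  then have l: "right_deriv \<theta> 0 = l" by (rule right_deriv_eqI) simp
  then show "(\<theta> has_real_derivative right_deriv \<theta> 0) (at 0 within {0..})" using D by simp
  show "continuous_on {0..} (right_deriv \<theta>)"
    unfolding continuous_on_eq_continuous_within
  proof
    fix z :: real assume z: "z \<in> {0..}"
    show "continuous (at z within {0..}) (right_deriv \<theta>)"
    proof (cases "z = 0")
      case True
      have "\<exists>d>0. \<forall>x\<in>{0..}. dist x 0 < d \<longrightarrow> dist (right_deriv \<theta> x) (right_deriv \<theta> 0) < e"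
        if e: "e > 0" for e
      proof -
        obtain d where d: "d > 0" "\<And>z. 0 < z \<Longrightarrow> z < d \<Longrightarrow> \<bar>deriv \<theta> z - l\<bar> < e"
          using near[OF e] by blast
        have "dist (right_deriv \<theta> x) (right_deriv \<theta> 0) < e" if "x \<in> {0..}" "dist x 0 < d" for x
          using that d e l kernel_right_deriv_pos[OF assms(1), of x]
          by (cases "x = 0") (auto simp: dist_real_def)
        then show ?thesis using d(1) by blast
      qed
      then show ?thesis unfolding True continuous_within_eps_delta by blast
    next
      case False
      then have pos: "0 < z" using z by simp
      have "isCont (deriv \<theta>) z"
        using assms(1) pos unfolding kernel_def
        by (auto intro: differentiable_imp_continuous_within)
      moreover have "eventually (\<lambda>x. right_deriv \<theta> x = deriv \<theta> x) (nhds z)"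
        using kernel_right_deriv_pos[OF assms(1)] pos
        by (auto intro!: eventually_mono[OF eventually_nhds_in_open[of "{0<..}"]])
      ultimately have "isCont (right_deriv \<theta>) z" using isCont_cong[of "right_deriv \<theta>" "deriv \<theta>" z] by simp
      then show ?thesis by (rule continuous_at_imp_continuous_at_within)
    qed
  qed
qed

section \<open>Prox-mappings of decomposable regularizers\<close>

lemma right_derivative_at_minimum:
  fixes f :: "real \<Rightarrow> real"
  assumes "(f has_real_derivative D) (at 0 within {0..1})" "\<And>s. 0 \<le> s \<Longrightarrow> s \<le> 1 \<Longrightarrow> f 0 \<le> f s"
  shows "0 \<le> D"
proof (rule tendsto_lowerbound)
  show "((\<lambda>s. (f s - f 0) / (s - 0)) \<longlongrightarrow> D) (at 0 within {0..1})"
    using assms(1) unfolding has_field_derivative_iff .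
  show "\<forall>\<^sub>F s in at 0 within {0..1}. 0 \<le> (f s - f 0) / (s - 0)"
    using assms(2) by (auto simp: eventually_at intro!: exI[of _ 1])
  show "at (0::real) within {0..1} \<noteq> bot"
    by (simp add: trivial_limit_within islimpt_Icc)
qed

lemma is_arg_min_prox:
  assumes "prox_defined X h dh x y"
  shows "is_arg_min (prox_obj h dh x y) (\<lambda>x'. x' \<in> X) (prox X h dh x y)"
  using assms unfolding prox_defined_def prox_def arg_min_def by (metis someI_ex)

locale decomposable_regularizer =
  fixes A :: "real^'n^'m" and b :: "real^'m" and N :: "real^'n \<Rightarrow> real"
    and h :: "real^'n \<Rightarrow> ereal" and dh :: "real^'n \<Rightarrow> real^'n" and \<theta> :: "real \<Rightarrow> real"
  assumes interior_point: "\<exists>x\<in>feasible A b. \<forall>i. 0 < x $ i"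
    and norm: "is_norm N"
    and regularizer: "bregman_regularizer N (feasible A b) h dh"
    and decomposable: "decomposable (feasible A b) h dh \<theta>"
begin

abbreviation X :: "(real^'n) set" where "X \<equiv> feasible A b"

abbreviation D :: "real^'n \<Rightarrow> real^'n \<Rightarrow> real" where "D \<equiv> bregman_div h dh"

text \<open>Real-valued counterpart of \<open>h\<close>, meaningful on \<open>X\<close> only, since
  \<open>h\<close> is \<infinity> elsewhere.\<close>

definition hr :: "real^'n \<Rightarrow> real" where "hr x = (\<Sum>i\<in>UNIV. \<theta> (x $ i))"

lemma kernel: "kernel \<theta>"
  using decomposable unfolding decomposable_def by blast

lemma h_eq: "x \<in> X \<Longrightarrow> h x = ereal (hr x)"
  using decomposable unfolding decomposable_def hr_def by blast

lemma h_outside: "x \<notin> X \<Longrightarrow> h x = \<infinity>"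
  using regularizer unfolding bregman_regularizer_def eff_dom_def by auto

lemma dh_eq: "x \<in> prox_dom h \<Longrightarrow> dh x = kernel_grad \<theta> x"
  using decomposable unfolding decomposable_def by blast

lemma feasible_nonneg: "x \<in> X \<Longrightarrow> 0 \<le> x $ i"
  unfolding feasible_def by blast

lemma feasible_segment:
  assumes "x \<in> X" "q \<in> X" "0 \<le> s" "s \<le> 1"
  shows "x + s *\<^sub>R (q - x) \<in> X"
proof -
  have "A *v (x + s *\<^sub>R (q - x)) = b"
    using assms by (simp add: feasible_def matrix_vector_right_distrib matrix_vector_mult_diff_distrib
        matrix_vector_mult_scaleR)
  moreover have "0 \<le> (x + s *\<^sub>R (q - x)) $ i" for i
  proof -
    have "(x + s *\<^sub>R (q - x)) $ i = (1 - s) * x $ i + s * q $ i" by (simp add: algebra_simps)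
    also have "0 \<le> \<dots>" using assms feasible_nonneg by (intro add_nonneg_nonneg mult_nonneg_nonneg) auto
    finally show ?thesis .
  qed
  ultimately show ?thesis unfolding feasible_def by blast
qed

text \<open>Points outside \<open>X\<close> impose no condition because \<open>h\<close> is
  \<infinity> there; subgradients are thereby described by real inequalities for
  \<open>hr\<close>.\<close>

lemma subgradient_iff:
  "v \<in> subdiff h x \<longleftrightarrow> x \<in> X \<and> (\<forall>q\<in>X. hr x + v \<bullet> (q - x) \<le> hr q)"
proof
  assume v: "v \<in> subdiff h x"
  then have x: "x \<in> X" using h_outside[of x] unfolding subdiff_def by force
  moreover have "hr x + v \<bullet> (q - x) \<le> hr q" if "q \<in> X" for q
  proof -
    have "h x + ereal (v \<bullet> (q - x)) \<le> h q" using v unfolding subdiff_def by blast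
    then show ?thesis using h_eq[OF x] h_eq[OF that] by simp
  qed
  ultimately show "x \<in> X \<and> (\<forall>q\<in>X. hr x + v \<bullet> (q - x) \<le> hr q)" by blast
next
  assume r: "x \<in> X \<and> (\<forall>q\<in>X. hr x + v \<bullet> (q - x) \<le> hr q)"
  have "h x + ereal (v \<bullet> (q - x)) \<le> h q" for q
    using r h_eq h_outside by (cases "q \<in> X") auto
  moreover have "\<bar>h x\<bar> \<noteq> \<infinity>" using r h_eq by simp
  ultimately show "v \<in> subdiff h x" unfolding subdiff_def by blast
qed

lemma prox_dom_feasible: "x \<in> prox_dom h \<Longrightarrow> x \<in> X"
  using subgradient_iff unfolding prox_dom_def by blast

lemma dh_subgradient: "x \<in> prox_dom h \<Longrightarrow> dh x \<in> subdiff h x"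
  using regularizer unfolding bregman_regularizer_def by blast

lemma bregman_eq:
  "p \<in> X \<Longrightarrow> x \<in> X \<Longrightarrow> D p x = hr p - hr x - dh x \<bullet> (p - x)"
  by (simp add: bregman_div_def h_eq)

lemma bregman_nonneg:
  assumes "x \<in> prox_dom h" "p \<in> X" shows "0 \<le> D p x"
  using dh_subgradient[OF assms(1)] assms subgradient_iff prox_dom_feasible bregman_eq by force

lemma bregman_strong:
  assumes "strongly_convex_wrt N 1 h dh U" "x \<in> prox_dom h" "x \<in> U" "p \<in> U" "p \<in> X"
  shows "(N (p - x))\<^sup>2 / 2 \<le> D p x"
proof -
  have "h x + ereal (dh x \<bullet> (p - x) + 1 / 2 * (N (p - x))\<^sup>2) \<le> h p"
    using assms unfolding strongly_convex_wrt_def by blast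
  then show ?thesis
    using h_eq[OF assms(5)] h_eq[OF prox_dom_feasible[OF assms(2)]]
      bregman_eq[OF assms(5) prox_dom_feasible[OF assms(2)]] by simp
qed

lemma hr_convex:
  assumes "x \<in> X" "q \<in> X" "0 \<le> s" "s \<le> 1"
  shows "hr (x + s *\<^sub>R (q - x)) \<le> (1 - s) * hr x + s * hr q"
proof (cases "s = 0 \<or> s = 1 \<or> x = q")
  case True
  then show ?thesis by (auto simp: algebra_simps)
next
  case False
  then have s: "s \<in> {0<..<1}" "x \<noteq> q" using assms by auto
  have "eff_dom h = X" "strictly_convex_fun h"
    using regularizer unfolding bregman_regularizer_def by blast+
  then have "h ((1 - s) *\<^sub>R x + s *\<^sub>R q) < ereal (1 - s) * h x + ereal s * h q"
    using s assms unfolding strictly_convex_fun_def by blast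
  moreover have eq: "(1 - s) *\<^sub>R x + s *\<^sub>R q = x + s *\<^sub>R (q - x)" by (simp add: algebra_simps)
  ultimately show ?thesis
    using h_eq[OF assms(1)] h_eq[OF assms(2)] h_eq[OF feasible_segment[OF assms]] by simp
qed

text \<open>
  Moving from \<open>x\<close> towards a positive point has slope \<open>\<theta>'(0+) = -\<infinity>\<close> in any vanishing coordinate,
  while a subgradient bounds this slope from below.
\<close>

lemma prox_dom_positive:
  assumes "\<not> euclidean_like \<theta>" "x \<in> prox_dom h"
  shows "0 < x $ i"
proof (rule ccontr)
  assume "\<not> 0 < x $ i"
  then have xi: "x $ i = 0"
    using feasible_nonneg[OF prox_dom_feasible[OF assms(2)], of i] by simp
  obtain q where q: "q \<in> X" "\<And>j. 0 < q $ j" using interior_point by blast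
  let ?d = "q - x" and ?v = "dh x"
  define C where "C = (\<Sum>j\<in>UNIV - {i}. ?d $ j * deriv \<theta> (q $ j))"
  obtain z where z: "0 < z" "\<And>u. 0 < u \<Longrightarrow> u \<le> z \<Longrightarrow> deriv \<theta> u < (?v \<bullet> ?d - C) / q $ i"
    using not_euclidean_like_deriv[OF kernel assms(1)] by metis
  \<comment> \<open>This step length brings the coordinate \<open>s * q $ i\<close> below the
    threshold \<open>z\<close>, while \<open>s \<le> 1\<close> keeps the point feasible.\<close>
  define s where "s = min 1 (z / q $ i)"
  have s: "0 < s" "s \<le> 1" "s * q $ i \<le> z" "0 < s * q $ i"
    using z(1) q(2)[of i] by (auto simp: s_def min_def field_simps)
  have xX: "x \<in> X" using assms(2) prox_dom_feasible by blast
  have "?v \<bullet> (s *\<^sub>R ?d) \<le> hr (x + s *\<^sub>R ?d) - hr x"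
    using dh_subgradient[OF assms(2)] feasible_segment[OF xX q(1), of s] s
    by (force simp: subgradient_iff)
  also have "\<dots> = (\<Sum>j\<in>UNIV. \<theta> (x $ j + s * ?d $ j) - \<theta> (x $ j))"
    by (simp add: hr_def sum_subtractf)
  also have "\<dots> = (\<Sum>j\<in>UNIV - {i}. \<theta> (x $ j + s * ?d $ j) - \<theta> (x $ j)) + (\<theta> (s * q $ i) - \<theta> 0)"
    using xi by (subst sum.remove[of UNIV i]) auto
  also have "\<dots> \<le> (\<Sum>j\<in>UNIV - {i}. s * (?d $ j * deriv \<theta> (q $ j))) + s * q $ i * deriv \<theta> (s * q $ i)"
  proof (intro add_mono sum_mono)
    fix j
    have x0: "0 \<le> x $ j" using xX feasible_nonneg by blast
    have eq: "x $ j + s * ?d $ j = (1 - s) * x $ j + s * q $ j" by (simp add: algebra_simps)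
    have pos: "0 < x $ j + s * ?d $ j"
      unfolding eq using s x0 q(2)[of j] by (intro add_nonneg_pos) auto
    have "\<theta> (x $ j + s * ?d $ j) - \<theta> (x $ j) \<le> s * ?d $ j * deriv \<theta> (x $ j + s * ?d $ j)"
      using kernel_tangent[OF kernel x0 pos] by simp
    \<comment> \<open>The moved point lies between \<open>x $ j\<close> and \<open>q $ j\<close>,
      and the sign of \<open>?d $ j\<close> tells in which order. Either way \<theta>' may be
      replaced by its value at \<open>q $ j\<close>, which does not depend on
      \<open>s\<close>.\<close>
    also have "\<dots> \<le> s * ?d $ j * deriv \<theta> (q $ j)"
    proof (cases "0 \<le> ?d $ j")
      case True
      have "s * ?d $ j \<le> 1 * ?d $ j" using True s by (intro mult_right_mono) auto
      then have "deriv \<theta> (x $ j + s * ?d $ j) \<le> deriv \<theta> (q $ j)"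
        by (intro kernel_deriv_mono[OF kernel pos]) simp
      then show ?thesis using True s by (intro mult_left_mono) auto
    next
      case False
      have "1 * ?d $ j \<le> s * ?d $ j" using False s by (intro mult_right_mono_neg) auto
      then have "deriv \<theta> (q $ j) \<le> deriv \<theta> (x $ j + s * ?d $ j)"
        by (intro kernel_deriv_mono[OF kernel q(2)]) simp
      then show ?thesis using False s by (intro mult_left_mono_neg) (auto simp: mult_le_0_iff)
    qed
    finally show "\<theta> (x $ j + s * ?d $ j) - \<theta> (x $ j) \<le> s * (?d $ j * deriv \<theta> (q $ j))"
      by (simp add: algebra_simps)
  next
    show "\<theta> (s * q $ i) - \<theta> 0 \<le> s * q $ i * deriv \<theta> (s * q $ i)"
      using kernel_tangent[OF kernel, of 0 "s * q $ i"] s by simp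
  qed
  also have "\<dots> = s * (C + q $ i * deriv \<theta> (s * q $ i))"
    by (simp add: C_def sum_distrib_left algebra_simps)
  finally have "?v \<bullet> ?d \<le> C + q $ i * deriv \<theta> (s * q $ i)"
    using s(1) by simp
  moreover have "deriv \<theta> (s * q $ i) < (?v \<bullet> ?d - C) / q $ i" using z(2) s by blast
  ultimately show False using q(2)[of i] by (simp add: field_simps)
qed

text \<open>Differentiability is in doubt only at a vanishing coordinate;
  \<open>prox_dom_positive\<close> then forces the Euclidean-like case, where the right derivative
  at \<open>0\<close> exists.\<close>

lemma kernel_grad_DERIV:
  assumes "x \<in> prox_dom h"
  shows "(\<theta> has_real_derivative kernel_grad \<theta> x $ i) (at (x $ i) within {0..})"
proof (cases "0 < x $ i")
  case True
  then show ?thesis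
    using kernel_DERIV[OF kernel True] kernel_right_deriv_pos[OF kernel True]
    by (simp add: kernel_grad_def has_field_derivative_at_within)
next
  case False
  then have "x $ i = 0" "euclidean_like \<theta>"
    using feasible_nonneg[OF prox_dom_feasible[OF assms], of i] prox_dom_positive[OF _ assms, of i] by auto
  then show ?thesis
    using euclidean_like_right_deriv(1)[OF kernel] by (simp add: kernel_grad_def)
qed

text \<open>Coordinatewise chain rule. Derivatives within the half-line suffice because the segment
  stays in the nonnegative orthant.\<close>

lemma hr_directional_derivative:
  assumes "x \<in> prox_dom h" "p \<in> X"
  shows "((\<lambda>s. hr (x + s *\<^sub>R (p - x))) has_real_derivative dh x \<bullet> (p - x)) (at 0 within {0..1})"
proof -
  have x: "x \<in> X" using assms prox_dom_feasible by blast
  have "((\<lambda>s. \<theta> ((x + s *\<^sub>R (p - x)) $ i)) has_real_derivative kernel_grad \<theta> x $ i * (p - x) $ i)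
      (at 0 within {0..1})" for i
  proof -
    let ?g = "\<lambda>s. x $ i + s * (p - x) $ i"
    have "?g ` {0..1} \<subseteq> {0..}"
      using feasible_nonneg[OF feasible_segment[OF x assms(2)], of _ i] by auto
    then have "(\<theta> has_real_derivative kernel_grad \<theta> x $ i) (at (?g 0) within ?g ` {0..1})"
      using kernel_grad_DERIV[OF assms(1), of i] by (auto intro: has_field_derivative_subset)
    moreover have "(?g has_real_derivative (p - x) $ i) (at 0 within {0..1})"
      by (auto intro!: derivative_eq_intros)
    ultimately show ?thesis using DERIV_image_chain[of \<theta> _ ?g 0 "{0..1}"] by (simp add: o_def)
  qed
  then show ?thesis
    unfolding hr_def dh_eq[OF assms(1)] inner_vec_def inner_real_def by (intro DERIV_sum) auto
qed

lemma prox_obj_eq: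
  "x \<in> X \<Longrightarrow> x' \<in> X \<Longrightarrow>
    prox_obj h dh x y x' = hr x' - (dh x + y) \<bullet> x' + (y \<bullet> x - hr x + dh x \<bullet> x)"
  by (simp add: prox_obj_def bregman_eq algebra_simps inner_simps)

lemma prox_minimal:
  assumes "x \<in> prox_dom h" "prox_defined X h dh x y" "z = prox X h dh x y"
  shows "z \<in> X" "\<And>q. q \<in> X \<Longrightarrow> hr z - (dh x + y) \<bullet> z \<le> hr q - (dh x + y) \<bullet> q"
  using is_arg_min_prox[OF assms(2)] prox_obj_eq[OF prox_dom_feasible[OF assms(1)]]
  unfolding is_arg_min_def assms(3) by (auto simp: not_less)

text \<open>Minimality makes \<open>dh x + y\<close> a subgradient at \<open>z\<close>, so
  \<open>z\<close> stays in \<open>prox_dom h\<close>. The selected subgradient \<open>dh z\<close>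
  may be a different one, so the inequality is derived separately, from the one-sided derivative of
  the objective along the segment to \<open>q\<close>.\<close>

lemma prox_optimal:
  assumes "x \<in> prox_dom h" "prox_defined X h dh x y" "z = prox X h dh x y"
  shows "z \<in> prox_dom h" "\<And>q. q \<in> X \<Longrightarrow> 0 \<le> (dh z - dh x - y) \<bullet> (q - z)"
proof -
  note m = prox_minimal[OF assms]
  have "dh x + y \<in> subdiff h z"
    using m by (auto simp: subgradient_iff inner_simps) (smt (verit) m(2))
  then show z: "z \<in> prox_dom h" unfolding prox_dom_def by blast
  show "0 \<le> (dh z - dh x - y) \<bullet> (q - z)" if q: "q \<in> X" for q
  proof (rule right_derivative_at_minimum)
    show "((\<lambda>s. hr (z + s *\<^sub>R (q - z)) - s * ((dh x + y) \<bullet> (q - z))) has_real_derivative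
        (dh z - dh x - y) \<bullet> (q - z)) (at 0 within {0..1})"
      by (rule derivative_eq_intros hr_directional_derivative[OF z q] refl)+ (simp add: inner_simps)
    show "hr (z + 0 *\<^sub>R (q - z)) - 0 * ((dh x + y) \<bullet> (q - z))
        \<le> hr (z + s *\<^sub>R (q - z)) - s * ((dh x + y) \<bullet> (q - z))" if "0 \<le> s" "s \<le> 1" for s
      using m(2)[OF feasible_segment[OF m(1) q that]] by (simp add: inner_simps)
  qed
qed

text \<open>\<open>D q x - D q z - D z x\<close> equals
  \<open>(dh z - dh x) \<bullet> (q - z)\<close>, which optimality of \<open>z\<close> bounds below
  by \<open>y \<bullet> (q - z)\<close>.\<close>

lemma prox_three_point:
  assumes "x \<in> prox_dom h" "prox_defined X h dh x y" "z = prox X h dh x y" "q \<in> X"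
  shows "D q z \<le> D q x - D z x - y \<bullet> (q - z)"
proof -
  have "z \<in> X" "x \<in> X" using prox_minimal(1)[OF assms(1-3)] prox_dom_feasible assms(1) by auto
  then have "D q x - D q z - D z x = (dh z - dh x) \<bullet> (q - z)"
    using assms(4) by (simp add: bregman_eq inner_simps)
  then show ?thesis using prox_optimal(2)[OF assms] by (simp add: inner_simps)
qed

text \<open>The prox objective is convex and minimal at \<open>z\<close>, so along the segment it
  never exceeds its value at \<open>q\<close>. This gives information at points where strong
  convexity still holds even if \<open>z\<close> itself is far away.\<close>

lemma prox_segment:
  assumes "x \<in> prox_dom h" "prox_defined X h dh x y" "z = prox X h dh x y" "q \<in> X"
    "0 \<le> s" "s \<le> 1"
  shows "D (q + s *\<^sub>R (z - q)) x \<le> D q x + s * (y \<bullet> (z - q))"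
proof -
  note m = prox_minimal[OF assms(1-3)]
  have X: "z \<in> X" "x \<in> X" "q + s *\<^sub>R (z - q) \<in> X"
    using m(1) prox_dom_feasible assms feasible_segment by auto
  have "s * (hr z - (dh x + y) \<bullet> z) \<le> s * (hr q - (dh x + y) \<bullet> q)"
    using m(2)[OF assms(4)] assms(5) by (rule mult_left_mono)
  then show ?thesis
    using hr_convex[OF assms(4) X(1) assms(5,6)] X assms(4)
    by (simp add: bregman_eq inner_simps algebra_simps)
qed

end

section \<open>Stability and convergence of the Bregman proximal method\<close>

text \<open>Monotonicity and strong convexity are assumed on one common ball of radius
  \<open>r\<close> in the norm \<open>N\<close>, to which the neighborhoods of the theorem are
  shrunk on interpretation.\<close>

locale bpm_local = decomposable_regularizer A b N h dh \<theta>
  for A :: "real^'n^'m" and b N h dh \<theta> +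
  fixes g :: "real^'n \<Rightarrow> real^'n" and xs :: "real^'n" and L \<mu> la lb \<gamma> r :: real
  assumes VI: "solves_VI (feasible A b) g xs"
    and L: "0 < L" and \<mu>: "0 < \<mu>" and r: "0 < r" and \<gamma>: "0 < \<gamma>"
    and lipschitz: "\<And>x x'. x \<in> feasible A b \<Longrightarrow> x' \<in> feasible A b \<Longrightarrow>
      dual_norm N (g x' - g x) \<le> L * N (x' - x)"
    and monotone: "\<And>x. x \<in> feasible A b \<Longrightarrow> N (x - xs) < r \<Longrightarrow>
      \<mu> * (N (x - xs))\<^sup>2 \<le> (g x - g xs) \<bullet> (x - xs)"
    and strong: "\<And>x p. x \<in> prox_dom h \<Longrightarrow> p \<in> feasible A b \<Longrightarrow> N (x - xs) < r \<Longrightarrow> N (p - xs) < r \<Longrightarrow>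
      (N (p - x))\<^sup>2 / 2 \<le> bregman_div h dh p x"
    and params: "bpm_params la lb"
    and step: "\<gamma> \<le> 1 / (2 * ((sqrt 5 + 1) / 2) * L)"
    and step_mix: "\<gamma> * (1 - la - lb)\<^sup>2 \<le> \<mu> / (8 * L\<^sup>2)"
begin

definition \<kappa> :: real where "\<kappa> = \<gamma> * L"

text \<open>If the energy is at most \<epsilon>, strong convexity with
  \<open>\<kappa> \<le> 1\<close> gives \<open>N (x - xs) \<le> r / 256\<close>, and the second
  energy term gives \<open>N (x - w) \<le> r / 256\<close>.\<close>

definition \<epsilon> :: real where "\<epsilon> = \<kappa> / 2 * (r / 256)\<^sup>2"

abbreviation gmix :: "real^'n \<Rightarrow> real^'n \<Rightarrow> real^'n" where
  "gmix x w \<equiv> la *\<^sub>R g x + lb *\<^sub>R g w"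

lemma xs_feasible: "xs \<in> X"
  using VI unfolding solves_VI_def by blast

lemma VI_ineq: "x \<in> X \<Longrightarrow> 0 \<le> g xs \<bullet> (x - xs)"
  using VI unfolding solves_VI_def by blast

lemma params_bounds: "0 \<le> la" "0 \<le> lb" "la + lb \<le> 1"
  using params unfolding bpm_params_def by auto

text \<open>The step-size condition says \<kappa> \<le> 1/(\<surd>5 + 1), about 0.309; a rational
  bound leaves linear arithmetic for the later estimates.\<close>

lemma \<kappa>_bounds: "0 < \<kappa>" "\<kappa> \<le> 31 / 100"
proof -
  show "0 < \<kappa>" using \<gamma> L by (simp add: \<kappa>_def)
  have s5: "2236 / 1000 \<le> sqrt 5" by (rule real_le_rsqrt) (simp add: power2_eq_square)
  have "2 * ((sqrt 5 + 1) / 2) * L = (sqrt 5 + 1) * L" by (simp add: field_simps)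
  then have "\<gamma> \<le> 1 / ((sqrt 5 + 1) * L)" using step by (simp only:)
  then have "\<kappa> \<le> 1 / ((sqrt 5 + 1) * L) * L"
    unfolding \<kappa>_def using L by (intro mult_right_mono) auto
  also have "\<dots> = 1 / (sqrt 5 + 1)" using L by simp
  also have "\<dots> \<le> 1 / (3236 / 1000)" using s5 by (intro divide_left_mono) auto
  finally show "\<kappa> \<le> 31 / 100" by simp
qed

lemma step_mix': "\<gamma> * L\<^sup>2 * (1 - la - lb)\<^sup>2 \<le> \<mu> / 8"
  using step_mix L by (simp add: field_simps)

lemma \<epsilon>_pos: "0 < \<epsilon>"
  using \<kappa>_bounds r by (simp add: \<epsilon>_def)

lemma g_pairing:
  assumes "x \<in> X" "x' \<in> X"
  shows "(g x' - g x) \<bullet> z \<le> L * N (x' - x) * N z"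
  using inner_le_dual_norm[OF norm, of "g x' - g x" z]
    mult_right_mono[OF lipschitz[OF assms] is_normD(6)[OF norm, of z]] by linarith

text \<open>
  The drift is decomposed around \<open>g xs\<close>, whose contribution has a sign by the variational
  inequality; the weight \<open>1/30\<close> in Young's inequality exploits the slack in
  \<open>3\<kappa>/2 \<le> 3/(2(\<surd>5 + 1)) < 1/2 - 1/30\<close>.
\<close>

lemma descent:
  assumes x: "x \<in> prox_dom h" and w: "w \<in> X"
    and z: "prox_defined X h dh x (- \<gamma> *\<^sub>R gmix x w)" "z = prox X h dh x (- \<gamma> *\<^sub>R gmix x w)"
    and x': "prox_defined X h dh x (- \<gamma> *\<^sub>R g z)" "x' = prox X h dh x (- \<gamma> *\<^sub>R g z)"
    and near: "N (x - xs) < r" "N (z - xs) < r" "N (x' - xs) < r"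
  shows "D xs x' + \<kappa> / 2 * (N (x' - z))\<^sup>2 + \<gamma> * \<mu> / 16 * (N (z - xs))\<^sup>2 + (N (z - x))\<^sup>2 / 4
    \<le> D xs x + \<kappa> / 2 * (N (x - w))\<^sup>2"
proof -
  let ?l = "1 - la - lb"
  define a d e a' where "a = N (x' - z)" and "d = N (z - x)" and "e = N (z - xs)" and "a' = N (x - w)"
  have nn: "0 \<le> a" "0 \<le> d" "0 \<le> e" "0 \<le> a'"
    unfolding a_def d_def e_def a'_def by (intro is_normD(6)[OF norm])+
  have zX: "z \<in> X" "z \<in> prox_dom h" using prox_minimal(1)[OF x z] prox_optimal(1)[OF x z] by auto
  have x'X: "x' \<in> X" using prox_minimal(1)[OF x x'] by auto
  have xX: "x \<in> X" using x prox_dom_feasible by blast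
  have T1: "D xs x' \<le> D xs x - D x' x + \<gamma> * (g z \<bullet> (xs - x'))"
    using prox_three_point[OF x x' xs_feasible] by simp
  have T2: "D x' z \<le> D x' x - D z x + \<gamma> * (gmix x w \<bullet> (x' - z))"
    using prox_three_point[OF x z x'X] by simp
  have S: "a\<^sup>2 / 2 \<le> D x' z" "d\<^sup>2 / 2 \<le> D z x"
    unfolding a_def d_def using strong zX x'X x near by auto
  have "N (z - w) \<le> d + a'" using is_norm_triangle[OF norm] by (simp add: d_def a'_def)
  then have zw: "L * N (z - w) * a \<le> L * (d + a') * a"
    using L nn by (intro mult_right_mono mult_left_mono) auto
  \<comment> \<open>The weights \<open>la\<close>, \<open>lb\<close> and \<open>?l\<close> add up to
    1. Accordingly \<open>g z\<close> is compared with \<open>g x\<close>, \<open>g w\<close> and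
    \<open>g xs\<close> in the pairing with \<open>z - x'\<close>; what remains of
    \<open>g xs\<close> is paired with differences whose sign is known.\<close>
  have split: "g z \<bullet> (xs - x') + gmix x w \<bullet> (x' - z) =
      - (?l * (g xs \<bullet> (x' - xs)) + (la + lb) * (g xs \<bullet> (z - xs))) - (g z - g xs) \<bullet> (z - xs)
      + (la * ((g z - g x) \<bullet> (z - x')) + lb * ((g z - g w) \<bullet> (z - x')) + ?l * ((g z - g xs) \<bullet> (z - x')))"
    by (simp add: inner_simps algebra_simps)
  have p1: "0 \<le> ?l * (g xs \<bullet> (x' - xs)) + (la + lb) * (g xs \<bullet> (z - xs))"
    using params_bounds VI_ineq zX x'X by (intro add_nonneg_nonneg mult_nonneg_nonneg) auto
  have p2: "\<mu> * e\<^sup>2 \<le> (g z - g xs) \<bullet> (z - xs)"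
    using monotone[OF zX(1) near(2)] by (simp add: e_def)
  have az: "N (z - x') = a" using is_normD(3)[OF norm] by (simp add: a_def)
  have "la * ((g z - g x) \<bullet> (z - x')) \<le> la * (L * d * a)"
    using g_pairing[OF xX zX(1), of "z - x'"] params_bounds unfolding az d_def by (intro mult_left_mono) auto
  moreover have "lb * ((g z - g w) \<bullet> (z - x')) \<le> lb * (L * (d + a') * a)"
    using g_pairing[OF w zX(1), of "z - x'"] params_bounds zw unfolding az by (intro mult_left_mono) auto
  moreover have "la * (L * d * a) + lb * (L * (d + a') * a) = (la + lb) * (L * d * a) + lb * (L * a' * a)"
    by (simp add: algebra_simps)
  moreover have "(la + lb) * (L * d * a) \<le> 1 * (L * d * a)" "lb * (L * a' * a) \<le> 1 * (L * a' * a)"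
    using params_bounds L nn by (intro mult_right_mono mult_nonneg_nonneg; auto)+
  moreover have "?l * ((g z - g xs) \<bullet> (z - x')) \<le> ?l * (L * e * a)"
    using g_pairing[OF xs_feasible zX(1), of "z - x'"] params_bounds unfolding az e_def
    by (intro mult_left_mono) auto
  ultimately have "g z \<bullet> (xs - x') + gmix x w \<bullet> (x' - z)
      \<le> - \<mu> * e\<^sup>2 + L * d * a + L * a' * a + ?l * (L * e * a)"
    using p1 p2 unfolding split by linarith
  from mult_left_mono[OF this, of \<gamma>]
  have "\<gamma> * (g z \<bullet> (xs - x')) + \<gamma> * (gmix x w \<bullet> (x' - z))
      \<le> - (\<gamma> * \<mu> * e\<^sup>2) + \<kappa> * (d * a) + \<kappa> * (a' * a) + (\<gamma> * ?l * L * e) * a"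
    using \<gamma> by (simp add: \<kappa>_def algebra_simps)
  moreover have "\<kappa> * (d * a) \<le> \<kappa> * d\<^sup>2 / 2 + \<kappa> * a\<^sup>2 / 2" "\<kappa> * (a' * a) \<le> \<kappa> * a'\<^sup>2 / 2 + \<kappa> * a\<^sup>2 / 2"
    using mult_left_mono[OF sum_squares_bound[of d a], of \<kappa>]
      mult_left_mono[OF sum_squares_bound[of a' a], of \<kappa>] \<kappa>_bounds by (simp_all add: algebra_simps)
  \<comment> \<open>By \<open>step_mix'\<close> the square of the factor of \<open>a\<close> is at
    most \<open>\<gamma> * \<mu> * e\<^sup>2 / 8\<close>. Since 15/2 times 1/8 is 15/16, a share of
    1/16 of the monotonicity term survives.\<close>
  moreover have "(\<gamma> * ?l * L * e) * a \<le> a\<^sup>2 / 30 + 15 / 16 * (\<gamma> * \<mu> * e\<^sup>2)"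
  proof -
    have young: "q * a \<le> a\<^sup>2 / 30 + 15 / 2 * q\<^sup>2" for q
      using zero_le_power2[of "a / 30 - q / 2"] by (simp add: power2_eq_square algebra_simps)
    have "(\<gamma> * ?l * L * e)\<^sup>2 = (\<gamma> * L\<^sup>2 * ?l\<^sup>2) * (\<gamma> * e\<^sup>2)" by (simp add: power2_eq_square)
    moreover have "(\<gamma> * L\<^sup>2 * ?l\<^sup>2) * (\<gamma> * e\<^sup>2) \<le> \<mu> / 8 * (\<gamma> * e\<^sup>2)"
      using step_mix' \<gamma> by (intro mult_right_mono) auto
    moreover have "\<mu> / 8 * (\<gamma> * e\<^sup>2) = (\<gamma> * \<mu> * e\<^sup>2) / 8" by simp
    ultimately show ?thesis using young[of "\<gamma> * ?l * L * e"] by linarith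
  qed
  moreover have "\<kappa> * d\<^sup>2 \<le> 31 / 100 * d\<^sup>2" "\<kappa> * a\<^sup>2 \<le> 31 / 100 * a\<^sup>2"
    using mult_right_mono[OF \<kappa>_bounds(2)] by simp_all
  moreover have "0 \<le> a\<^sup>2" "0 \<le> d\<^sup>2" by simp_all
  ultimately have "D xs x' + \<kappa> * a\<^sup>2 / 2 + \<gamma> * \<mu> * e\<^sup>2 / 16 + d\<^sup>2 / 4 \<le> D xs x + \<kappa> * a'\<^sup>2 / 2"
    using T1 T2 S by linarith
  then show ?thesis by (simp add: a_def d_def e_def a'_def)
qed

text \<open>
  Strong convexity holds only near \<open>xs\<close>, so a far away prox point is excluded by evaluating the
  convex prox objective where the segment to it leaves the \<open>\<rho>\<close>-ball.
\<close>

lemma prox_near: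
  assumes x: "x \<in> prox_dom h" and z: "prox_defined X h dh x (- \<gamma> *\<^sub>R v)" "z = prox X h dh x (- \<gamma> *\<^sub>R v)"
    and l: "0 \<le> l"
    and v: "\<And>u. (v - l *\<^sub>R g xs) \<bullet> u \<le> L * (\<rho> / 8) * N u"
    and \<rho>: "0 < \<rho>" "\<rho> < r" and near: "N (x - xs) \<le> \<rho> / 8" "D xs x \<le> 3 / 10 * \<rho>\<^sup>2"
  shows "N (z - xs) < \<rho>"
proof (rule ccontr)
  assume "\<not> N (z - xs) < \<rho>"
  then have n: "\<rho> \<le> N (z - xs)" by simp
  define s where "s = \<rho> / N (z - xs)"
  have s: "0 \<le> s" "s \<le> 1" "s * N (z - xs) = \<rho>" using n \<rho> by (auto simp: s_def)
  define q where "q = xs + s *\<^sub>R (z - xs)"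
  have zX: "z \<in> X" using prox_minimal(1)[OF x z] .
  have q: "q \<in> X" unfolding q_def using feasible_segment[OF xs_feasible zX s(1,2)] .
  have qr: "N (q - xs) = \<rho>" using s by (simp add: q_def is_normD(4)[OF norm])
  have "D q x \<le> D xs x + s * ((- \<gamma> *\<^sub>R v) \<bullet> (z - xs))"
    unfolding q_def by (rule prox_segment[OF x z xs_feasible s(1,2)])
  also have "s * ((- \<gamma> *\<^sub>R v) \<bullet> (z - xs)) = \<gamma> * ((v - l *\<^sub>R g xs) \<bullet> (xs - q) - l * (g xs \<bullet> (q - xs)))"
    by (simp add: q_def inner_simps algebra_simps)
  also have "\<dots> \<le> \<gamma> * (L * (\<rho> / 8) * \<rho>)"
  proof (intro mult_left_mono)
    have "0 \<le> l * (g xs \<bullet> (q - xs))" using l VI_ineq[OF q] by simp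
    then show "(v - l *\<^sub>R g xs) \<bullet> (xs - q) - l * (g xs \<bullet> (q - xs)) \<le> L * (\<rho> / 8) * \<rho>"
      using v[of "xs - q"] qr is_normD(3)[OF norm, of xs q] by simp
  qed (use \<gamma> in simp)
  also have "\<gamma> * (L * (\<rho> / 8) * \<rho>) = \<kappa> * (\<rho>\<^sup>2 / 8)" by (simp add: \<kappa>_def power2_eq_square)
  also have "\<dots> \<le> 31 / 100 * (\<rho>\<^sup>2 / 8)" using \<kappa>_bounds by (intro mult_right_mono) auto
  finally have up: "D q x \<le> (3 / 10 + 31 / 800) * \<rho>\<^sup>2" using near by simp
  have "7 / 8 * \<rho> \<le> N (q - x)"
    using is_norm_triangle[OF norm, of q xs x] qr near by simp
  then have "(7 / 8 * \<rho>)\<^sup>2 \<le> (N (q - x))\<^sup>2" using \<rho> by (intro power_mono) auto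
  also have "(N (q - x))\<^sup>2 \<le> 2 * D q x" using strong[OF x q] near \<rho> qr by auto
  \<comment> \<open>After division by \<open>\<rho>\<^sup>2\<close> the contradiction is 49/64,
    about 0.766, against 0.6775.\<close>
  finally have "(7 / 8 * \<rho>)\<^sup>2 \<le> 2 * ((3 / 10 + 31 / 800) * \<rho>\<^sup>2)" using up by simp
  moreover have "0 < \<rho>\<^sup>2" using \<rho> by simp
  ultimately show False by (simp add: power_mult_distrib power_divide)
qed

text \<open>\<open>w\<close> stands for the preceding half-step iterate; the bounded quantity is the
  Lyapunov function.\<close>

definition inv_state :: "real^'n \<Rightarrow> real^'n \<Rightarrow> bool" where
  "inv_state x w \<longleftrightarrow> x \<in> prox_dom h \<and> w \<in> X \<and> N (x - xs) < r \<and>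
     D xs x + \<kappa> / 2 * (N (x - w))\<^sup>2 \<le> \<epsilon>"

text \<open>A bootstrap: the energy bound places \<open>x\<close> and \<open>w\<close> within
  \<open>r / 128\<close> of \<open>xs\<close>. Each use of \<open>prox_near\<close> loses a factor
  8, so \<open>z\<close> is within \<open>r / 16\<close> and \<open>x'\<close> within
  \<open>r / 2\<close>. Thus \<open>descent\<close> applies and the energy bound persists.\<close>

lemma inv_state_step:
  assumes inv: "inv_state x w"
    and z: "prox_defined X h dh x (- \<gamma> *\<^sub>R gmix x w)" "z = prox X h dh x (- \<gamma> *\<^sub>R gmix x w)"
    and x': "prox_defined X h dh x (- \<gamma> *\<^sub>R g z)" "x' = prox X h dh x (- \<gamma> *\<^sub>R g z)"
  shows "inv_state x' z"
    and "D xs x' + \<kappa> / 2 * (N (x' - z))\<^sup>2 + \<gamma> * \<mu> / 16 * (N (z - xs))\<^sup>2 + (N (z - x))\<^sup>2 / 4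
      \<le> D xs x + \<kappa> / 2 * (N (x - w))\<^sup>2"
proof -
  note nonneg = is_normD(6)[OF norm]
  have x: "x \<in> prox_dom h" and w: "w \<in> X" and xr: "N (x - xs) < r"
    and E: "D xs x + \<kappa> / 2 * (N (x - w))\<^sup>2 \<le> \<epsilon>"
    using inv unfolding inv_state_def by auto
  have xX: "x \<in> X" using x prox_dom_feasible by blast
  have D0: "0 \<le> D xs x" by (rule bregman_nonneg[OF x xs_feasible])
  have "0 \<le> \<kappa> / 2 * (N (x - w))\<^sup>2" using \<kappa>_bounds by simp
  then have D\<epsilon>: "D xs x \<le> \<epsilon>" using E by linarith
  have \<epsilon>1: "\<epsilon> \<le> (r / 256)\<^sup>2 / 2"
    using \<kappa>_bounds mult_right_mono[of \<kappa> 1 "(r / 256)\<^sup>2 / 2"] by (simp add: \<epsilon>_def)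
  have xs0: "N (xs - xs) < r" using r is_normD(1)[OF norm] by simp
  have "(N (x - xs))\<^sup>2 \<le> 2 * D xs x"
    using strong[OF x xs_feasible xr xs0] is_normD(3)[OF norm, of x xs] by simp
  then have "(N (x - xs))\<^sup>2 \<le> (r / 256)\<^sup>2" using D\<epsilon> \<epsilon>1 by linarith
  then have x1: "N (x - xs) \<le> r / 256" by (rule power2_le_imp_le) (use r in simp)
  have "\<kappa> / 2 * (N (x - w))\<^sup>2 \<le> \<kappa> / 2 * (r / 256)\<^sup>2" using E D0 unfolding \<epsilon>_def by linarith
  then have "(N (x - w))\<^sup>2 \<le> (r / 256)\<^sup>2" using \<kappa>_bounds by simp
  then have "N (x - w) \<le> r / 256" by (rule power2_le_imp_le) (use r in simp)
  then have w1: "N (w - xs) \<le> r / 128"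
    using is_norm_triangle[OF norm, of w xs x] is_normD(3)[OF norm, of w x] x1 by simp
  have z1: "N (z - xs) < r / 16"
  proof (rule prox_near[OF x z, where l = "la + lb"])
    fix u
    have "(gmix x w - (la + lb) *\<^sub>R g xs) \<bullet> u = la * ((g x - g xs) \<bullet> u) + lb * ((g w - g xs) \<bullet> u)"
      by (simp add: inner_simps algebra_simps)
    also have "\<dots> \<le> la * (L * (r / 128) * N u) + lb * (L * (r / 128) * N u)"
    proof (intro add_mono mult_left_mono)
      have "L * N (x - xs) * N u \<le> L * (r / 128) * N u"
        using x1 r L nonneg by (intro mult_right_mono mult_left_mono) auto
      then show "(g x - g xs) \<bullet> u \<le> L * (r / 128) * N u"
        using g_pairing[OF xs_feasible xX, of u] by linarith
      have "L * N (w - xs) * N u \<le> L * (r / 128) * N u"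
        using w1 L nonneg by (intro mult_right_mono mult_left_mono) auto
      then show "(g w - g xs) \<bullet> u \<le> L * (r / 128) * N u"
        using g_pairing[OF xs_feasible w, of u] by linarith
    qed (use params_bounds in auto)
    also have "\<dots> = (la + lb) * (L * (r / 128) * N u)" by (simp add: algebra_simps)
    also have "\<dots> \<le> 1 * (L * (r / 128) * N u)"
      using params_bounds L r nonneg by (intro mult_right_mono) auto
    finally show "(gmix x w - (la + lb) *\<^sub>R g xs) \<bullet> u \<le> L * (r / 16 / 8) * N u" by simp
  next
    show "D xs x \<le> 3 / 10 * (r / 16)\<^sup>2"
      using D\<epsilon> \<epsilon>1 zero_le_power2[of r] by (simp add: power_divide; linarith)
  qed (use params_bounds r x1 in auto)
  have zX: "z \<in> X" using prox_minimal(1)[OF x z] .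
  have x'1: "N (x' - xs) < r / 2"
  proof (rule prox_near[OF x x', where l = 1])
    fix u
    have "L * N (z - xs) * N u \<le> L * (r / 16) * N u"
      using z1 L nonneg by (intro mult_right_mono mult_left_mono) auto
    then show "(g z - 1 *\<^sub>R g xs) \<bullet> u \<le> L * (r / 2 / 8) * N u"
      using g_pairing[OF xs_feasible zX, of u] by simp
  next
    show "D xs x \<le> 3 / 10 * (r / 2)\<^sup>2"
      using D\<epsilon> \<epsilon>1 zero_le_power2[of r] unfolding power_divide by (simp; linarith)
  qed (use r x1 in auto)
  show desc: "D xs x' + \<kappa> / 2 * (N (x' - z))\<^sup>2 + \<gamma> * \<mu> / 16 * (N (z - xs))\<^sup>2 + (N (z - x))\<^sup>2 / 4
      \<le> D xs x + \<kappa> / 2 * (N (x - w))\<^sup>2"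
    using descent[OF x w z x' xr] z1 x'1 r by simp
  have "0 \<le> \<gamma> * \<mu> / 16 * (N (z - xs))\<^sup>2 + (N (z - x))\<^sup>2 / 4" using \<gamma> \<mu> by simp
  then have "D xs x' + \<kappa> / 2 * (N (x' - z))\<^sup>2 \<le> \<epsilon>" using desc E by linarith
  then show "inv_state x' z"
    using prox_optimal(1)[OF x x'] zX x'1 r unfolding inv_state_def by simp
qed

end

locale bpm_run = bpm_local A b N h dh \<theta> g xs L \<mu> la lb \<gamma> r
  for A :: "real^'n^'m" and b N h dh \<theta> g xs L \<mu> la lb \<gamma> r +
  fixes x xh :: "nat \<Rightarrow> real^'n"
  assumes bpm: "bpm (feasible A b) h dh g la lb (\<lambda>_. \<gamma>) x xh"
    and init: "N (x 1 - xs) < r" "bregman_div h dh xs (x 1) \<le> \<epsilon>"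
begin

lemma bpm_step:
  assumes "1 \<le> t"
  shows "prox_defined X h dh (x t) (- \<gamma> *\<^sub>R gmix (x t) (xh (t - 1)))"
    "xh t = prox X h dh (x t) (- \<gamma> *\<^sub>R gmix (x t) (xh (t - 1)))"
    "prox_defined X h dh (x t) (- \<gamma> *\<^sub>R g (xh t))"
    "x (Suc t) = prox X h dh (x t) (- \<gamma> *\<^sub>R g (xh t))"
  using bpm assms unfolding bpm_def by (auto simp: Let_def)

lemma bpm_inv_state:
  assumes "1 \<le> t" shows "inv_state (x t) (xh (t - 1))"
  using assms
proof (induction t rule: dec_induct)
  \<comment> \<open>Since \<open>xh 0 = x 1\<close>, the second energy term vanishes
    initially.\<close>
  case base
  have "x 1 \<in> prox_dom h" "xh 0 = x 1" using bpm unfolding bpm_def by auto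
  then show ?case
    using init prox_dom_feasible is_normD(1)[OF norm] unfolding inv_state_def by simp
next
  case (step t)
  then show ?case using inv_state_step(1)[OF step.IH bpm_step[OF step(1)]] by simp
qed

lemma bpm_prox_dom: "1 \<le> t \<Longrightarrow> x t \<in> prox_dom h"
  using bpm_inv_state unfolding inv_state_def by blast

lemma bpm_feasible: "1 \<le> t \<Longrightarrow> x t \<in> X" "1 \<le> t \<Longrightarrow> xh t \<in> X"
  using bpm_prox_dom prox_dom_feasible bpm_inv_state[of "Suc t"] unfolding inv_state_def by auto

text \<open>The energy is nonnegative and decreasing, so its decrements tend to 0; they dominate the
  squares of the distances from \<open>xh t\<close> to \<open>xs\<close> and to
  \<open>x t\<close>.\<close>

lemma bpm_converges:
  "(\<lambda>t. N (xh t - xs)) \<longlonglongrightarrow> 0" "(\<lambda>t. N (x t - xs)) \<longlonglongrightarrow> 0"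
proof -
  note nonneg = is_normD(6)[OF norm]
  \<comment> \<open>The shift starts the sequence at \<open>x 1\<close>, because \<open>x 0\<close>
    is junk.\<close>
  define E where "E t = D xs (x (Suc t)) + \<kappa> / 2 * (N (x (Suc t) - xh t))\<^sup>2" for t
  let ?e = "\<lambda>t. N (xh (Suc t) - xs)" and ?d = "\<lambda>t. N (xh (Suc t) - x (Suc t))"
  have desc: "E (Suc t) + \<gamma> * \<mu> / 16 * (?e t)\<^sup>2 + (?d t)\<^sup>2 / 4 \<le> E t" for t
    using inv_state_step(2)[OF bpm_inv_state[of "Suc t"] bpm_step[of "Suc t"]] by (simp add: E_def)
  have gm: "0 < \<gamma> * \<mu> / 16" using \<gamma> \<mu> by simp
  have "decseq E"
  proof (rule decseq_SucI)
    fix t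
    have "0 \<le> \<gamma> * \<mu> / 16 * (?e t)\<^sup>2 + (?d t)\<^sup>2 / 4" using gm by simp
    then show "E (Suc t) \<le> E t" using desc[of t] by linarith
  qed
  moreover have "0 \<le> E t" for t
    unfolding E_def using bregman_nonneg[OF bpm_prox_dom xs_feasible, of "Suc t"] \<kappa>_bounds by simp
  ultimately obtain l where l: "E \<longlonglongrightarrow> l" using decseq_convergent by metis
  have "(\<lambda>t. E t - E (Suc t)) \<longlonglongrightarrow> l - l" using l LIMSEQ_Suc[OF l] by (intro tendsto_diff)
  then have diff: "(\<lambda>t. E t - E (Suc t)) \<longlonglongrightarrow> 0" by simp
  have sq: "f \<longlonglongrightarrow> 0" if f: "\<And>t. 0 \<le> f t" "\<And>t. c * (f t)\<^sup>2 \<le> E t - E (Suc t)" "0 < c" for f :: "nat \<Rightarrow> real" and c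
  proof -
    have "(\<lambda>t. (f t)\<^sup>2) \<longlonglongrightarrow> 0"
    proof (rule tendsto_sandwich[of "\<lambda>_. 0" _ _ "\<lambda>t. (E t - E (Suc t)) / c"])
      show "(\<lambda>t. (E t - E (Suc t)) / c) \<longlonglongrightarrow> 0" using tendsto_divide[OF diff tendsto_const[of c]] f(3) by simp
      show "\<forall>\<^sub>F t in sequentially. (f t)\<^sup>2 \<le> (E t - E (Suc t)) / c" using f by (simp add: field_simps)
    qed auto
    then have "(\<lambda>t. sqrt ((f t)\<^sup>2)) \<longlonglongrightarrow> sqrt 0" by (rule tendsto_real_sqrt)
    then show ?thesis using f(1) by simp
  qed
  have bounds: "\<gamma> * \<mu> / 16 * (?e t)\<^sup>2 \<le> E t - E (Suc t)" "1 / 4 * (?d t)\<^sup>2 \<le> E t - E (Suc t)" for t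
  proof -
    have "0 \<le> (?d t)\<^sup>2 / 4" "0 \<le> \<gamma> * \<mu> / 16 * (?e t)\<^sup>2" using gm by simp_all
    then show "\<gamma> * \<mu> / 16 * (?e t)\<^sup>2 \<le> E t - E (Suc t)" "1 / 4 * (?d t)\<^sup>2 \<le> E t - E (Suc t)"
      using desc[of t] by linarith+
  qed
  have e: "?e \<longlonglongrightarrow> 0" by (rule sq[OF nonneg bounds(1) gm])
  have d: "?d \<longlonglongrightarrow> 0" by (rule sq[OF nonneg bounds(2)]) simp
  show "(\<lambda>t. N (xh t - xs)) \<longlonglongrightarrow> 0" using e by (rule LIMSEQ_imp_Suc)
  have "(\<lambda>t. N (x (Suc t) - xs)) \<longlonglongrightarrow> 0"
  proof (rule tendsto_sandwich[of "\<lambda>_. 0" _ _ "\<lambda>t. ?d t + ?e t"])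
    show "(\<lambda>t. ?d t + ?e t) \<longlonglongrightarrow> 0" using tendsto_add[OF d e] by simp
    show "\<forall>\<^sub>F t in sequentially. N (x (Suc t) - xs) \<le> ?d t + ?e t"
      using is_norm_triangle[OF norm] is_normD(3)[OF norm] by (intro always_eventually) metis
  qed (use nonneg in auto)
  then show "(\<lambda>t. N (x t - xs)) \<longlonglongrightarrow> 0" by (rule LIMSEQ_imp_Suc)
qed

end

section \<open>An error bound for faces\<close>

lemma feasible_polyhedron: "polyhedron (feasible (A :: real^'n^'m) b)"
proof -
  have "feasible A b =
      \<Inter> (range (\<lambda>i. {x. axis i 1 \<bullet> x \<ge> 0})) \<inter> \<Inter> (range (\<lambda>j. {x. A $ j \<bullet> x = b $ j}))"
    by (auto simp: feasible_def inner_axis' vec_eq_iff matrix_vector_mul_component)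
  also have "polyhedron \<dots>"
    by (intro polyhedron_Int polyhedron_Inter) (auto simp: polyhedron_halfspace_ge polyhedron_hyperplane)
  finally show ?thesis .
qed

text \<open>
  Near \<open>xs\<close> the feasible set is a polytope: write \<open>x\<close> as a convex combination of vertices and
  replace those off the face by \<open>xs\<close>.
\<close>

lemma face_error_bound:
  fixes A :: "real^'n^'m"
  assumes xs: "xs \<in> feasible A b"
  obtains H where "0 < H"
    "\<And>x S. x \<in> feasible A b \<Longrightarrow> (\<forall>i. \<bar>x $ i - xs $ i\<bar> \<le> 1) \<Longrightarrow> S \<subseteq> active xs \<Longrightarrow>
      \<exists>y\<in>feasible A b. (\<forall>i\<in>S. y $ i = 0) \<and> norm (x - y) \<le> H * (\<Sum>i\<in>S. x $ i)"
proof -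
  let ?X = "feasible A b"
  define P where "P = ?X \<inter> cbox (xs - vec 1) (xs + vec 1)"
  have P_iff: "x \<in> P \<longleftrightarrow> x \<in> ?X \<and> (\<forall>i. \<bar>x $ i - xs $ i\<bar> \<le> 1)" for x
    by (simp add: P_def mem_box_cart abs_le_iff algebra_simps) (smt (verit))
  have "polytope P"
    unfolding P_def by (intro polytope_Int_polyhedron[of "cbox _ _", unfolded Int_commute[of "cbox _ _"]]
        polytope_interval feasible_polyhedron)
  then obtain V where V: "finite V" "P = convex hull V" unfolding polytope_def by blast
  then have VP: "V \<subseteq> P" by (simp add: hull_subset)
  have convX: "convex ?X" using feasible_polyhedron polyhedron_imp_convex by blast
  define m where "m S v = (\<Sum>i\<in>S. v $ i)" for S and v :: "real^'n"
  have m0: "0 \<le> m S v" if "v \<in> ?X" for S v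
    unfolding m_def using that by (intro sum_nonneg) (auto simp: feasible_def)
  \<comment> \<open>All coordinate sets are taken together, so the final constant does not depend on
    \<open>S\<close>, hence not on \<nu>. There are finitely many, so a least positive sum exists;
    the inserted \<open>1\<close> covers an empty \<open>W\<close>.\<close>
  define W where "W = {m S v | S v. v \<in> V \<and> 0 < m S v}"
  have "W \<subseteq> (\<lambda>(S, v). m S v) ` (UNIV \<times> V)" unfolding W_def by auto
  then have finW: "finite W" by (rule finite_subset) (use V in auto)
  define \<delta> where "\<delta> = Min (insert 1 W)"
  have "0 < \<delta>" unfolding \<delta>_def using finW by (auto simp: W_def)
  moreover have "\<delta> \<le> m S v" if "v \<in> V" "0 < m S v" for S v
    unfolding \<delta>_def using finW that by (intro Min_le) (auto simp: W_def)
  ultimately have \<delta>: "0 < \<delta>" "\<And>S v. v \<in> V \<Longrightarrow> 0 < m S v \<Longrightarrow> \<delta> \<le> m S v" by blast+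
  define R where "R = 1 + (\<Sum>v\<in>V. norm (v - xs))"
  have R: "norm (v - xs) \<le> R" if "v \<in> V" for v
    using member_le_sum[OF that, of "\<lambda>v. norm (v - xs)"] V(1) unfolding R_def by simp
  have R0: "0 < R" unfolding R_def by (intro add_pos_nonneg sum_nonneg) auto
  show ?thesis
  proof (rule that)
    show "0 < R / \<delta>" using R0 \<delta> by simp
    fix x S
    assume x: "x \<in> ?X" "\<forall>i. \<bar>x $ i - xs $ i\<bar> \<le> 1" and S: "S \<subseteq> active xs"
    then have "x \<in> convex hull V" using P_iff V(2) by blast
    then obtain u where u: "\<And>v. v \<in> V \<Longrightarrow> 0 \<le> u v" "sum u V = 1" "(\<Sum>v\<in>V. u v *\<^sub>R v) = x"
      unfolding convex_hull_finite[OF V(1)] by blast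
    define f where "f v = (if m S v = 0 then v else xs)" for v
    define y where "y = (\<Sum>v\<in>V. u v *\<^sub>R f v)"
    have VX: "v \<in> ?X" if "v \<in> V" for v using that VP P_def by blast
    have "y \<in> ?X"
      unfolding y_def using u xs VX by (intro convex_sum[OF V(1) convX]) (auto simp: f_def)
    moreover have "\<forall>i\<in>S. y $ i = 0"
    proof
      fix i assume i: "i \<in> S"
      have "f v $ i = 0" if v: "v \<in> V" for v
      proof (cases "m S v = 0")
        case True
        then have "\<forall>i\<in>S. v $ i = 0"
          unfolding m_def using VX[OF v] by (subst (asm) sum_nonneg_eq_0_iff) (auto simp: feasible_def)
        then show ?thesis using True i by (simp add: f_def)
      next
        case False
        then show ?thesis using S i by (auto simp: f_def active_def)
      qed
      then show "y $ i = 0" by (simp add: y_def)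
    qed
    moreover have "norm (x - y) \<le> R / \<delta> * (\<Sum>i\<in>S. x $ i)"
    proof -
      have "x - y = (\<Sum>v\<in>V. u v *\<^sub>R (v - f v))"
        by (simp add: y_def u(3)[symmetric] sum_subtractf scaleR_diff_right)
      also have "norm \<dots> \<le> (\<Sum>v\<in>V. u v * (R / \<delta> * m S v))"
      proof (intro order_trans[OF norm_sum] sum_mono)
        fix v assume v: "v \<in> V"
        \<comment> \<open>A vertex off the face moves by at most \<open>R\<close>, while its
          coordinate sum over \<open>S\<close> is at least \<delta>; a vertex on the face does not
          move.\<close>
        have "norm (v - f v) \<le> R / \<delta> * m S v"
        proof (cases "m S v = 0")
          case False
          then have "\<delta> \<le> m S v" using \<delta>(2)[OF v] m0[OF VX[OF v], of S] by simp
          then have "R / \<delta> * \<delta> \<le> R / \<delta> * m S v" using R0 \<delta> by (intro mult_left_mono) auto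
          then show ?thesis using R[OF v] False \<delta> by (simp add: f_def)
        qed (simp add: f_def)
        then have "\<bar>u v\<bar> * norm (v - f v) \<le> u v * (R / \<delta> * m S v)"
          using u(1)[OF v] by (intro mult_mono) auto
        then show "norm (u v *\<^sub>R (v - f v)) \<le> u v * (R / \<delta> * m S v)" by (simp only: norm_scaleR)
      qed
      also have "\<dots> = R / \<delta> * (\<Sum>v\<in>V. u v * m S v)"
        unfolding sum_distrib_left by (intro sum.cong) auto
      also have "(\<Sum>v\<in>V. u v * m S v) = (\<Sum>i\<in>S. x $ i)"
        unfolding m_def u(3)[symmetric] sum_distrib_left
        by (subst sum.swap) simp
      finally show ?thesis .
    qed
    ultimately show "\<exists>y\<in>?X. (\<forall>i\<in>S. y $ i = 0) \<and> norm (x - y) \<le> R / \<delta> * (\<Sum>i\<in>S. x $ i)" by blast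
  qed
qed

text \<open>\<open>row_sp A\<close> is orthogonal to the kernel of \<open>A\<close>, so along kernel
  directions only the slackness part of \<open>g p\<close> is seen.\<close>

lemma slackness_inner:
  assumes "slackness A g p \<nu>" "A *v z = 0"
  shows "g p \<bullet> z = (\<Sum>i\<in>active p. \<nu> i * z $ i)"
proof -
  have "(g p - (\<Sum>i\<in>active p. \<nu> i *\<^sub>R axis i 1)) \<bullet> z = 0"
    using assms unfolding slackness_def row_sp_def orthogonal_comp_def
    by (auto simp: orthogonal_def inner_commute)
  then show ?thesis by (simp add: inner_diff_left inner_sum_left inner_axis')
qed

section \<open>Identification and rates\<close>

text \<open>\<open>H\<close> is a parameter fixed independently of the run. Nonemptiness of the
  sharp set makes \<open>sharpness\<close> a genuine minimum.\<close>

locale bpm_rates = bpm_run A b N h dh \<theta> g xs L \<mu> la lb \<gamma> r x xh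
  for A :: "real^'n^'m" and b N h dh \<theta> g xs L \<mu> la lb \<gamma> r x xh +
  fixes \<nu> :: "'n \<Rightarrow> real" and H :: real
  assumes slack: "slackness A g xs \<nu>"
    and sharp_nonempty: "sharp_dirs xs \<nu> \<noteq> {}"
    and H: "0 < H"
    and error_bound: "\<And>x S. x \<in> feasible A b \<Longrightarrow> (\<forall>i. \<bar>x $ i - xs $ i\<bar> \<le> 1) \<Longrightarrow> S \<subseteq> active xs \<Longrightarrow>
      \<exists>y\<in>feasible A b. (\<forall>i\<in>S. y $ i = 0) \<and> norm (x - y) \<le> H * (\<Sum>i\<in>S. x $ i)"
begin

abbreviation sharp :: "'n set" where "sharp \<equiv> sharp_dirs xs \<nu>"

abbreviation flat :: "'n set" where "flat \<equiv> flat_dirs xs \<nu>"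

abbreviation \<nu>s :: real where "\<nu>s \<equiv> sharpness xs \<nu>"

definition S :: "nat \<Rightarrow> real" where "S t = (\<Sum>i\<in>sharp. x t $ i)"

lemma sharp_flat: "active xs = sharp \<union> flat" "sharp \<inter> flat = {}"
  using slack unfolding slackness_def sharp_dirs_def flat_dirs_def by force+

lemma sharpness_pos: "0 < \<nu>s"
  using sharp_nonempty by (simp add: sharpness_def sharp_dirs_def)

lemma sharpness_le: "i \<in> sharp \<Longrightarrow> \<nu>s \<le> \<nu> i"
  by (simp add: sharpness_def)

lemma coord_le_S: "1 \<le> t \<Longrightarrow> i \<in> sharp \<Longrightarrow> x t $ i \<le> S t"
  unfolding S_def using feasible_nonneg[OF bpm_feasible(1)] by (intro member_le_sum) auto

lemma S_nonneg: "1 \<le> t \<Longrightarrow> 0 \<le> S t"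
  unfolding S_def using feasible_nonneg[OF bpm_feasible(1)] by (intro sum_nonneg) auto

lemma x_tendsto: "(\<lambda>t. x t $ i) \<longlonglongrightarrow> xs $ i"
proof -
  obtain c where c: "c > 0" "\<And>v. c * norm v \<le> N v" using is_norm_lower[OF norm] by blast
  have "(\<lambda>t. norm (x t - xs)) \<longlonglongrightarrow> 0"
  proof (rule tendsto_sandwich[of "\<lambda>_. 0" _ _ "\<lambda>t. N (x t - xs) / c"])
    show "(\<lambda>t. N (x t - xs) / c) \<longlonglongrightarrow> 0"
      using tendsto_divide[OF bpm_converges(2) tendsto_const[of c]] c by simp
    show "\<forall>\<^sub>F t in sequentially. norm (x t - xs) \<le> N (x t - xs) / c"
      using c by (simp add: field_simps)
  qed auto
  then have "x \<longlonglongrightarrow> xs" by (simp add: tendsto_norm_zero_iff LIM_zero_iff)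
  then show ?thesis by (rule tendsto_vec_nth)
qed

lemma sharp_tendsto: "i \<in> active xs \<Longrightarrow> (\<lambda>t. x t $ i) \<longlonglongrightarrow> 0"
  using x_tendsto[of i] by (simp add: active_def)

text \<open>Convergence of the half-step iterates and Lipschitz continuity of \<open>g\<close>,
  restated in the Euclidean norm because the face error bound is Euclidean.\<close>

lemma gradient_eventually:
  assumes "0 < \<eta>"
  shows "eventually (\<lambda>t. \<forall>z. (g xs - g (xh t)) \<bullet> z \<le> \<eta> * norm z) sequentially"
proof -
  obtain C where C: "C > 0" "\<And>v. N v \<le> C * norm v" using is_norm_upper[OF norm] by blast
  have "eventually (\<lambda>t. N (xh t - xs) < \<eta> / (L * C)) sequentially"
    using order_tendstoD(2)[OF bpm_converges(1)] assms L C(1) by simp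
  with eventually_ge_at_top[of 1] show ?thesis
  proof eventually_elim
    case (elim t)
    show ?case
    proof
      fix z
      have "(g xs - g (xh t)) \<bullet> z \<le> L * N (xs - xh t) * N z"
        using elim by (intro g_pairing bpm_feasible xs_feasible) auto
      also have "\<dots> \<le> L * (\<eta> / (L * C)) * (C * norm z)"
        using elim L C assms is_normD(3,6)[OF norm] by (intro mult_mono) (auto intro: less_imp_le)
      also have "\<dots> = \<eta> * norm z" using L C by simp
      finally show "(g xs - g (xh t)) \<bullet> z \<le> \<eta> * norm z" .
    qed
  qed
qed

lemma face_point_eventually:
  "eventually (\<lambda>t. \<exists>y\<in>X. (\<forall>i\<in>sharp. y $ i = 0) \<and> norm (x t - y) \<le> H * S t) sequentially"
proof -
  have "eventually (\<lambda>t. \<bar>x t $ i - xs $ i\<bar> < 1) sequentially" for i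
    using x_tendsto[of i] tendstoD[of _ "xs $ i" _ 1] by (simp add: dist_real_def)
  then have "eventually (\<lambda>t. \<forall>i. \<bar>x t $ i - xs $ i\<bar> < 1) sequentially"
    by (simp add: eventually_all_finite)
  with eventually_ge_at_top[of 1] show ?thesis
  proof eventually_elim
    case (elim t)
    then show ?case
      unfolding S_def using sharp_flat(1) by (intro error_bound bpm_feasible) (auto intro: less_imp_le)
  qed
qed

text \<open>The kernel direction \<open>x t - y\<close> sees only slackness coefficients: flat ones
  vanish, sharp ones are at least \<open>\<nu>s\<close>, and on sharp coordinates the difference is
  \<open>x t\<close> itself.\<close>

lemma face_difference:
  assumes "1 \<le> t" "y \<in> X" "\<forall>i\<in>sharp. y $ i = 0"
  shows "A *v (x t - y) = 0" "\<nu>s * S t \<le> g xs \<bullet> (x t - y)"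
proof -
  show ker: "A *v (x t - y) = 0"
    using bpm_feasible(1)[OF assms(1)] assms(2)
    by (simp add: feasible_def matrix_vector_mult_diff_distrib)
  have "\<nu>s * S t \<le> (\<Sum>i\<in>sharp. \<nu> i * (x t - y) $ i)"
    unfolding S_def sum_distrib_left using assms(1,3) sharpness_le feasible_nonneg[OF bpm_feasible(1)]
    by (intro sum_mono) (simp add: mult_right_mono)
  also have "\<dots> = (\<Sum>i\<in>active xs. \<nu> i * (x t - y) $ i)"
    unfolding sharp_flat(1) by (rule sum.mono_neutral_left) (auto simp: flat_dirs_def)
  also have "\<dots> = g xs \<bullet> (x t - y)"
    using slackness_inner[OF slack ker] by simp
  finally show "\<nu>s * S t \<le> g xs \<bullet> (x t - y)" .
qed

lemma euclidean_identification:
  assumes "euclidean_like \<theta>"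
  shows "eventually (\<lambda>t. \<forall>i\<in>sharp. x t $ i = 0) sequentially"
proof -
  have "(\<lambda>t. dh (x t) $ i) \<longlonglongrightarrow> right_deriv \<theta> (xs $ i)" for i
  proof -
    have "(\<lambda>t. right_deriv \<theta> (x t $ i)) \<longlonglongrightarrow> right_deriv \<theta> (xs $ i)"
      using euclidean_like_right_deriv(2)[OF kernel assms] x_tendsto
      by (rule continuous_on_tendsto_compose)
        (use feasible_nonneg xs_feasible bpm_feasible(1) in
          \<open>auto intro!: eventually_mono[OF eventually_ge_at_top[of 1]]\<close>)
    then show ?thesis
      by (rule Lim_transform_eventually)
        (auto intro!: eventually_mono[OF eventually_ge_at_top[of 1]]
          simp: dh_eq[OF bpm_prox_dom] kernel_grad_def)
  qed
  then have "(\<lambda>t. dh (x t)) \<longlonglongrightarrow> (\<chi> i. right_deriv \<theta> (xs $ i))"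
    by (simp add: vec_tendstoI)
  from tendsto_norm[OF tendsto_diff[OF this LIMSEQ_Suc[OF this]]]
  have d: "(\<lambda>t. norm (dh (x t) - dh (x (Suc t)))) \<longlonglongrightarrow> 0" by simp
  \<comment> \<open>Two errors, from the gradient of \<open>h\<close> and from \<open>g\<close>,
    each cost at most \<eta> \<open>* H\<close> times \<open>S (Suc t)\<close>; together they absorb
    only half of the drift.\<close>
  define \<eta> where "\<eta> = \<nu>s / (4 * H)"
  have \<eta>: "0 < \<eta>" "\<eta> * H = \<nu>s / 4" using sharpness_pos H by (auto simp: \<eta>_def)
  have "eventually (\<lambda>t. norm (dh (x t) - dh (x (Suc t))) < \<gamma> * \<eta>) sequentially"
    using order_tendstoD(2)[OF d] \<eta> \<gamma> by simp
  moreover have "eventually (\<lambda>t. \<exists>y\<in>X. (\<forall>i\<in>sharp. y $ i = 0) \<and> norm (x (Suc t) - y) \<le> H * S (Suc t)) sequentially"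
    using face_point_eventually
      eventually_sequentially_Suc[of "\<lambda>t. \<exists>y\<in>X. (\<forall>i\<in>sharp. y $ i = 0) \<and> norm (x t - y) \<le> H * S t"]
    by blast
  ultimately have "eventually (\<lambda>t. \<forall>i\<in>sharp. x (Suc t) $ i = 0) sequentially"
    using gradient_eventually[OF \<eta>(1)] eventually_ge_at_top[of 1]
  proof eventually_elim
    case (elim t)
    then obtain y where y: "y \<in> X" "\<forall>i\<in>sharp. y $ i = 0" "norm (x (Suc t) - y) \<le> H * S (Suc t)" by blast
    let ?z = "x (Suc t) - y"
    note S0 = S_nonneg[of "Suc t", simplified]
    have "0 \<le> (dh (x (Suc t)) - dh (x t) - - \<gamma> *\<^sub>R g (xh t)) \<bullet> (y - x (Suc t))"
      using prox_optimal(2)[OF bpm_prox_dom bpm_step(3,4) y(1)] elim by blast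
    then have "\<gamma> * (g xs \<bullet> ?z) \<le> (dh (x t) - dh (x (Suc t))) \<bullet> ?z + \<gamma> * ((g xs - g (xh t)) \<bullet> ?z)"
      by (simp add: inner_simps algebra_simps)
    also have "\<dots> \<le> \<gamma> * \<eta> * norm ?z + \<gamma> * (\<eta> * norm ?z)"
    proof (intro add_mono mult_left_mono)
      have "(dh (x t) - dh (x (Suc t))) \<bullet> ?z \<le> norm (dh (x t) - dh (x (Suc t))) * norm ?z"
        by (rule norm_cauchy_schwarz)
      also have "\<dots> \<le> \<gamma> * \<eta> * norm ?z" using elim by (intro mult_right_mono) auto
      finally show "(dh (x t) - dh (x (Suc t))) \<bullet> ?z \<le> \<gamma> * \<eta> * norm ?z" .
    qed (use elim \<gamma> in auto)
    also have "\<dots> = \<gamma> * (2 * \<eta> * norm ?z)" by simp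
    finally have "g xs \<bullet> ?z \<le> 2 * \<eta> * norm ?z" using \<gamma> by simp
    also have "\<dots> \<le> 2 * \<eta> * (H * S (Suc t))" using y(3) \<eta> by (intro mult_left_mono) auto
    also have "\<dots> = \<nu>s / 2 * S (Suc t)" using \<eta>(2) by (simp add: algebra_simps)
    finally have "\<nu>s * S (Suc t) \<le> \<nu>s / 2 * S (Suc t)"
      using face_difference(2)[of "Suc t" y] y by simp
    then have "S (Suc t) = 0" using sharpness_pos S0 by (simp add: mult_le_cancel_left)
    then show ?case
      using coord_le_S[of "Suc t"] feasible_nonneg[OF bpm_feasible(1), of "Suc t"] by (auto intro: antisym)
  qed
  then show ?thesis
    using eventually_sequentially_Suc[of "\<lambda>t. \<forall>i\<in>sharp. x t $ i = 0"] by blast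
qed

text \<open>Outside the Euclidean-like case all iterates are positive, so kernel directions may be
  followed both ways and the optimality inequality becomes an equality, which can be summed over
  time.\<close>

lemma telescoped_optimality:
  assumes ne: "\<not> euclidean_like \<theta>" and T: "1 \<le> T0" "T0 \<le> T" and z: "A *v z = 0"
  shows "dh (x T) \<bullet> z = dh (x T0) \<bullet> z - \<gamma> * (\<Sum>t=T0..<T. g (xh t) \<bullet> z)"
  using T(2)
proof (induction T rule: dec_induct)
  case base
  then show ?case by simp
next
  case (step t)
  then have t: "1 \<le> t" using T(1) by simp
  define m where "m = Min (range (\<lambda>i. x (Suc t) $ i))"
  have m: "0 < m" "\<And>i. m \<le> x (Suc t) $ i"
    unfolding m_def using prox_dom_positive[OF ne bpm_prox_dom] by auto
  \<comment> \<open>Small enough that no coordinate of \<open>x (Suc t)\<close> becomes negative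
    under a step \<open>s\<close> or \<open>- s\<close> along \<open>z\<close>; the
    \<open>+ 1\<close> avoids division by zero.\<close>
  define s where "s = m / (norm z + 1)"
  have s: "0 < s" using m by (simp add: s_def add_nonneg_pos)
  have "m * norm z \<le> m * (norm z + 1)" using m(1) by (intro mult_left_mono) auto
  then have "s * norm z \<le> m" by (simp add: s_def pos_divide_le_eq add_nonneg_pos)
  then have small: "s * \<bar>z $ i\<bar> \<le> m" for i
    using order_trans[OF mult_left_mono[OF component_le_norm_cart[of z i], of s]] s by simp
  have feas: "x (Suc t) + c *\<^sub>R z \<in> X" if "\<bar>c\<bar> = s" for c
  proof -
    have "0 \<le> x (Suc t) $ i + c * z $ i" for i
      using small[of i] m(2)[of i] that abs_mult[of c "z $ i"] by (smt (verit))
    then show ?thesis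
      using bpm_feasible(1)[of "Suc t"] z
      by (simp add: feasible_def matrix_vector_right_distrib matrix_vector_mult_scaleR)
  qed
  let ?d = "(dh (x (Suc t)) - dh (x t) - - \<gamma> *\<^sub>R g (xh t)) \<bullet> z"
  have "0 \<le> c * ?d" if "\<bar>c\<bar> = s" for c
    using prox_optimal(2)[OF bpm_prox_dom[OF t] bpm_step(3,4)[OF t] feas[OF that]] by simp
  from this[of s] this[of "- s"] have "?d = 0" using s by (simp add: zero_le_mult_iff mult_le_0_iff)
  then have "dh (x (Suc t)) \<bullet> z = dh (x t) \<bullet> z - \<gamma> * (g (xh t) \<bullet> z)"
    by (simp add: inner_simps)
  then show ?case using step by (simp add: algebra_simps)
qed

text \<open>
  The vector \<open>w\<close> collects the positive parts of \<open>x t - y\<close> on the active coordinates, where \<open>y\<close> is a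
  nearby point of the face; by monotonicity of \<open>\<theta>'\<close> the iterate itself can be replaced by \<open>w\<close>
  inside \<open>\<theta>'\<close>. At \<open>w i = 0\<close> the product is \<open>0\<close> regardless of the junk value of \<open>deriv \<theta> 0\<close>.
\<close>

lemma weighted_dual_bound:
  assumes ne: "\<not> euclidean_like \<theta>"
  obtains C where "eventually (\<lambda>t. \<exists>w. (\<forall>i. 0 \<le> w i \<and> w i \<le> max 1 H * S t) \<and>
      (\<Sum>i\<in>active xs. w i) \<le> (1 + real (card flat) * H) * S t \<and>
      (\<forall>i\<in>active xs. w i \<le> x t $ i) \<and>
      (\<Sum>i\<in>active xs. w i * deriv \<theta> (w i)) \<le> (C - \<gamma> * \<nu>s * real t / 2) * S t) sequentially"
proof -
  \<comment> \<open>The gradient error then costs at most half of the drift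
    \<open>\<nu>s * S t\<close> in each summand, whence the factor 1/2 in the rates.\<close>
  define \<eta> where "\<eta> = \<nu>s / (2 * H)"
  have \<eta>: "0 < \<eta>" "\<eta> * H = \<nu>s / 2" using sharpness_pos H by (auto simp: \<eta>_def)
  obtain T0 where T0: "1 \<le> T0" "\<And>t z. T0 \<le> t \<Longrightarrow> (g xs - g (xh t)) \<bullet> z \<le> \<eta> * norm z"
  proof -
    obtain T where "\<And>t z. T \<le> t \<Longrightarrow> (g xs - g (xh t)) \<bullet> z \<le> \<eta> * norm z"
      using gradient_eventually[OF \<eta>(1)] unfolding eventually_sequentially by blast
    then show ?thesis using that[of "max 1 T"] by simp
  qed
  \<comment> \<open>\<open>M\<close> bounds the contribution of the inactive coordinates, where
    \<theta>' converges. \<open>C\<close> also absorbs the dual vector at time \<open>T0\<close> and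
    the drift missing before \<open>T0\<close>.\<close>
  define M where "M = (\<Sum>i\<in>UNIV. \<bar>deriv \<theta> (xs $ i)\<bar> + 1)"
  define C where "C = (norm (dh (x T0)) + M) * H + \<gamma> * \<nu>s * real T0 / 2"
  \<comment> \<open>Near \<open>0\<close> the derivative is negative, so an active coordinate with
    nonpositive \<open>?z $ i\<close> contributes a nonnegative product and may be dropped, in
    accordance with \<open>w i = 0\<close>.\<close>
  obtain u where u: "0 < u" "\<And>v. 0 < v \<Longrightarrow> v \<le> u \<Longrightarrow> deriv \<theta> v < 0"
    using not_euclidean_like_deriv[OF kernel ne] by metis
  have "eventually (\<lambda>t. x t $ i < u) sequentially" if "i \<in> active xs" for i
    using order_tendstoD(2)[OF sharp_tendsto[OF that]] u(1) by blast
  then have ev_active: "eventually (\<lambda>t. \<forall>i\<in>active xs. x t $ i < u) sequentially"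
    by (simp add: eventually_ball_finite)
  have "eventually (\<lambda>t. \<bar>deriv \<theta> (x t $ i)\<bar> < \<bar>deriv \<theta> (xs $ i)\<bar> + 1) sequentially" if "i \<notin> active xs" for i
  proof -
    have "0 < xs $ i" using that feasible_nonneg[OF xs_feasible, of i] by (simp add: active_def)
    then have "isCont (deriv \<theta>) (xs $ i)"
      using kernel unfolding kernel_def by (auto intro: differentiable_imp_continuous_within)
    then have "(\<lambda>t. \<bar>deriv \<theta> (x t $ i)\<bar>) \<longlonglongrightarrow> \<bar>deriv \<theta> (xs $ i)\<bar>"
      by (intro tendsto_rabs isCont_tendsto_compose[OF _ x_tendsto])
    then show ?thesis by (rule order_tendstoD(2)) simp
  qed
  then have "eventually (\<lambda>t. \<forall>i\<in>- active xs. \<bar>deriv \<theta> (x t $ i)\<bar> < \<bar>deriv \<theta> (xs $ i)\<bar> + 1) sequentially"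
    by (simp add: eventually_ball_finite)
  then show ?thesis
    using ev_active face_point_eventually eventually_ge_at_top[of T0]
  proof (rule that[of C, OF eventually_elim2[OF eventually_conj eventually_conj]], goal_cases)
    case (1 t)
    then have t: "1 \<le> t" "T0 \<le> t" using T0 by auto
    from 1 obtain y where y: "y \<in> X" "\<forall>i\<in>sharp. y $ i = 0" "norm (x t - y) \<le> H * S t" by blast
    let ?z = "x t - y"
    have pos: "0 < x t $ i" for i using prox_dom_positive[OF ne bpm_prox_dom[OF t(1)]] .
    note S0 = S_nonneg[OF t(1)]
    have zi: "\<bar>?z $ i\<bar> \<le> H * S t" for i using component_le_norm_cart[of ?z i] y(3) by simp
    define w where "w i = max 0 (?z $ i)" for i
    have w0: "0 \<le> w i" for i by (simp add: w_def)
    have w_sharp: "w i = x t $ i" if "i \<in> sharp" for i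
      using that y(2) pos[of i] by (simp add: w_def)
    have w_flat: "w i \<le> H * S t" for i using zi[of i] H S0 by (simp add: w_def)
    have w_le: "w i \<le> x t $ i" for i
      using feasible_nonneg[OF y(1), of i] pos[of i] by (simp add: w_def)
    have "H * S t \<le> max 1 H * S t" using S0 by (intro mult_right_mono) auto
    then have b1: "\<forall>i. 0 \<le> w i \<and> w i \<le> max 1 H * S t" using w0 w_flat order_trans by blast
    have "(\<Sum>i\<in>active xs. w i) = (\<Sum>i\<in>sharp. w i) + (\<Sum>i\<in>flat. w i)"
      unfolding sharp_flat(1) using sharp_flat(2) by (intro sum.union_disjoint) auto
    also have "(\<Sum>i\<in>sharp. w i) = S t" unfolding S_def using w_sharp by simp
    also have "(\<Sum>i\<in>flat. w i) \<le> real (card flat) * (H * S t)" using w_flat by (intro sum_bounded_above) auto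
    finally have b2: "(\<Sum>i\<in>active xs. w i) \<le> (1 + real (card flat) * H) * S t" by (simp add: algebra_simps)
    have "(\<Sum>i\<in>active xs. w i * deriv \<theta> (w i)) - M * (H * S t) \<le>
        (\<Sum>i\<in>active xs. deriv \<theta> (x t $ i) * ?z $ i) + (\<Sum>i\<in>- active xs. deriv \<theta> (x t $ i) * ?z $ i)"
    proof -
      have "(\<Sum>i\<in>active xs. w i * deriv \<theta> (w i)) \<le> (\<Sum>i\<in>active xs. deriv \<theta> (x t $ i) * ?z $ i)"
      proof (intro sum_mono)
        fix i assume i: "i \<in> active xs"
        show "w i * deriv \<theta> (w i) \<le> deriv \<theta> (x t $ i) * ?z $ i"
        proof (cases "0 < ?z $ i")
          case True
          then have "w i * deriv \<theta> (w i) \<le> w i * deriv \<theta> (x t $ i)"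
            using w_le[of i] kernel_deriv_mono[OF kernel, of "w i" "x t $ i"] by (simp add: w_def)
          then show ?thesis using True by (simp add: w_def algebra_simps)
        next
          case False
          moreover have "deriv \<theta> (x t $ i) < 0" using u(2) pos i 1 by (auto intro: less_imp_le)
          ultimately show ?thesis by (simp add: w_def zero_le_mult_iff)
        qed
      qed
      moreover have "(\<Sum>i\<in>- active xs. - (deriv \<theta> (x t $ i) * ?z $ i)) \<le>
          (\<Sum>i\<in>- active xs. (\<bar>deriv \<theta> (xs $ i)\<bar> + 1) * (H * S t))"
      proof (intro sum_mono)
        fix i assume i: "i \<in> - active xs"
        have "- (deriv \<theta> (x t $ i) * ?z $ i) \<le> \<bar>deriv \<theta> (x t $ i)\<bar> * \<bar>?z $ i\<bar>"
          by (metis abs_ge_minus_self abs_mult)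
        also have "\<dots> \<le> (\<bar>deriv \<theta> (xs $ i)\<bar> + 1) * (H * S t)"
          using zi[of i] i 1 by (intro mult_mono) (auto intro: less_imp_le)
        finally show "- (deriv \<theta> (x t $ i) * ?z $ i) \<le> (\<bar>deriv \<theta> (xs $ i)\<bar> + 1) * (H * S t)" .
      qed
      moreover have "(\<Sum>i\<in>- active xs. (\<bar>deriv \<theta> (xs $ i)\<bar> + 1) * (H * S t)) \<le> M * (H * S t)"
        unfolding M_def sum_distrib_right using H S0 by (intro sum_mono2) auto
      ultimately show ?thesis by (simp add: sum_negf)
    qed
    also have "\<dots> = dh (x t) \<bullet> ?z"
    proof -
      have "dh (x t) \<bullet> ?z = (\<Sum>i\<in>UNIV. deriv \<theta> (x t $ i) * ?z $ i)"
        using dh_eq[OF bpm_prox_dom[OF t(1)]] kernel_right_deriv_pos[OF kernel pos]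
        by (simp add: inner_vec_def kernel_grad_def)
      then show ?thesis
        by (metis (no_types, lifting) Compl_disjoint Compl_partition finite sum.union_disjoint)
    qed
    also have "\<dots> = dh (x T0) \<bullet> ?z - \<gamma> * (\<Sum>t'=T0..<t. g (xh t') \<bullet> ?z)"
      by (rule telescoped_optimality[OF ne T0(1) t(2) face_difference(1)[OF t(1) y(1,2)]])
    also have "\<dots> \<le> norm (dh (x T0)) * (H * S t) - \<gamma> * (real (t - T0) * (\<nu>s / 2 * S t))"
    proof (intro diff_mono mult_left_mono)
      show "dh (x T0) \<bullet> ?z \<le> norm (dh (x T0)) * (H * S t)"
        using norm_cauchy_schwarz[of "dh (x T0)" ?z] mult_left_mono[OF y(3), of "norm (dh (x T0))"] by simp
      have "\<nu>s / 2 * S t \<le> g (xh t') \<bullet> ?z" if "t' \<in> {T0..<t}" for t'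
      proof -
        have "(g xs - g (xh t')) \<bullet> ?z \<le> \<eta> * (H * S t)"
          using T0(2)[of t' ?z] that order_trans[OF _ mult_left_mono[OF y(3), of \<eta>]] \<eta>(1) by simp
        also have "\<dots> = \<nu>s / 2 * S t" using \<eta>(2) by (simp add: mult.assoc[symmetric])
        finally show ?thesis using face_difference(2)[OF t(1) y(1,2)] by (simp add: inner_diff_left)
      qed
      then show "real (t - T0) * (\<nu>s / 2 * S t) \<le> (\<Sum>t'=T0..<t. g (xh t') \<bullet> ?z)"
        using sum_bounded_below[of "{T0..<t}" "\<nu>s / 2 * S t" "\<lambda>t'. g (xh t') \<bullet> ?z"] by simp
    qed (use \<gamma> in simp)
    finally have "(\<Sum>i\<in>active xs. w i * deriv \<theta> (w i)) \<le> (C - \<gamma> * \<nu>s * real t / 2) * S t"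
      using t(2) by (simp add: C_def of_nat_diff algebra_simps diff_divide_distrib)
    then show ?case using b1 b2 w_le by blast
  qed
qed

end

text \<open>This is ln v \<le> v - 1 at v = S/w. It replaces the logarithms of the individual
  weights by the common \<open>ln S\<close> at a cost linear in \<open>S\<close>.\<close>

lemma mult_ln_ge:
  fixes S w :: real
  assumes "0 < S" "0 \<le> w"
  shows "w * ln S - S \<le> w * ln w"
proof (cases "w = 0")
  case False
  then have w: "0 < w" using assms by simp
  have "ln (S / w) \<le> S / w - 1" using assms w by (intro ln_le_minus_one) simp
  then have "w * ln (S / w) \<le> w * (S / w - 1)" using w by (intro mult_left_mono) auto
  also have "\<dots> \<le> S" using w by (simp add: field_simps)
  finally show ?thesis using assms w by (simp add: ln_div algebra_simps)
qed (use assms in simp)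

section \<open>Rates for entropy-like and power-like kernels\<close>

context bpm_rates
begin

lemma S_pos:
  assumes "\<not> euclidean_like \<theta>" "1 \<le> t" shows "0 < S t"
  unfolding S_def using sharp_nonempty prox_dom_positive[OF assms(1) bpm_prox_dom[OF assms(2)]]
  by (intro sum_pos) auto

lemma S_tendsto: "S \<longlonglongrightarrow> 0"
proof -
  have "(\<lambda>t. \<Sum>i\<in>sharp. x t $ i) \<longlonglongrightarrow> (\<Sum>i\<in>sharp. 0)"
    using sharp_flat(1) by (intro tendsto_sum sharp_tendsto) auto
  then show ?thesis by (simp add: S_def[abs_def])
qed

text \<open>The full dimension replaces \<open>card flat\<close>, which depends on \<nu>.\<close>

definition \<rho> :: real where "\<rho> = 1 + real CARD('n) * H"

lemma eff_sharpness_pos: "0 < eff_sharpness xs \<nu> \<rho>"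
  using sharpness_pos H by (simp add: eff_sharpness_def \<rho>_def add_pos_nonneg)

lemma \<rho>_ge_1: "1 \<le> \<rho>"
  using H by (simp add: \<rho>_def)

text \<open>Without flat directions the factor on the left is 1 and nothing is lost; this explains
  the case distinction in \<open>eff_sharpness\<close>.\<close>

lemma eff_sharpness_le:
  "(1 + real (card flat) * H) * eff_sharpness xs \<nu> \<rho> \<le> \<nu>s"
proof (cases "flat = {}")
  case True
  then show ?thesis by (simp add: eff_sharpness_def)
next
  case False
  have "real (card flat) \<le> real CARD('n)" using card_mono[of UNIV flat] by simp
  then have "1 + real (card flat) * H \<le> \<rho>" using H by (simp add: \<rho>_def)
  then have "(1 + real (card flat) * H) * eff_sharpness xs \<nu> \<rho> \<le> \<rho> * eff_sharpness xs \<nu> \<rho>"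
    using eff_sharpness_pos by (intro mult_right_mono) auto
  also have "\<dots> = \<nu>s" using False \<rho>_ge_1 by (simp add: eff_sharpness_def)
  finally show ?thesis .
qed

text \<open>With ln u - c \<le> \<theta>'(u), the weighted bound, divided by \<open>S t\<close>,
  bounds \<open>?q * ln (S t)\<close> above by a decreasing affine function of
  \<open>t\<close>.\<close>

lemma entropy_rate:
  assumes "entropy_like \<theta>" "i \<in> sharp"
  shows "(\<lambda>t. x t $ i) \<in> O(\<lambda>t. exp (- \<gamma> * eff_sharpness xs \<nu> \<rho> * real t / 2))"
proof -
  let ?e = "eff_sharpness xs \<nu> \<rho>" and ?q = "1 + real (card flat) * H"
  have ne: "\<not> euclidean_like \<theta>" using assms(1) unfolding entropy_like_def by blast
  have q: "1 \<le> ?q" using H by simp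
  have lim: "- \<infinity> < Liminf (at_right 0) (\<lambda>u. ereal (deriv \<theta> u - ln u))"
    using assms(1) unfolding entropy_like_def by blast
  obtain c0 d where d: "0 < d" and c0: "\<And>u. 0 < u \<Longrightarrow> u < d \<Longrightarrow> c0 \<le> deriv \<theta> u - ln u"
    using Liminf_at_right_0_lower[OF lim] by auto
  define c where "c = \<bar>c0\<bar>"
  have c: "0 \<le> c" "ln u - c \<le> deriv \<theta> u" if "0 < u" "u < d" for u
    using c0[OF that] by (auto simp: c_def)
  obtain C where C: "eventually (\<lambda>t. \<exists>w. (\<forall>i. 0 \<le> w i \<and> w i \<le> max 1 H * S t) \<and>
      (\<Sum>i\<in>active xs. w i) \<le> ?q * S t \<and> (\<forall>i\<in>active xs. w i \<le> x t $ i) \<and>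
      (\<Sum>i\<in>active xs. w i * deriv \<theta> (w i)) \<le> (C - \<gamma> * \<nu>s * real t / 2) * S t) sequentially"
    by (rule weighted_dual_bound[OF ne])
  define n where "n = real (card (active xs))"
  define K where "K = (C + n + c * ?q) / ?q"
  have c_nonneg: "0 \<le> c" by (simp add: c_def)
  have "eventually (\<lambda>t. \<forall>i\<in>active xs. x t $ i < d) sequentially"
    using order_tendstoD(2)[OF sharp_tendsto] d by (simp add: eventually_ball_finite)
  moreover have "eventually (\<lambda>t. S t < 1) sequentially"
    using order_tendstoD(2)[OF S_tendsto] by simp
  ultimately have "eventually (\<lambda>t. norm (x t $ i) \<le> exp K * norm (exp (- \<gamma> * ?e * real t / 2))) sequentially"
    using C eventually_ge_at_top[of 1]
  proof eventually_elim
    case (elim t)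
    then obtain w where w: "\<And>i. 0 \<le> w i" "(\<Sum>i\<in>active xs. w i) \<le> ?q * S t"
      "\<And>i. i \<in> active xs \<Longrightarrow> w i \<le> x t $ i"
      "(\<Sum>i\<in>active xs. w i * deriv \<theta> (w i)) \<le> (C - \<gamma> * \<nu>s * real t / 2) * S t" by blast
    have S0: "0 < S t" using S_pos[OF ne] elim by blast
    \<comment> \<open>Enlarging the weight sum to \<open>?q * S t\<close> lowers the expression
      because \<open>ln (S t)\<close> is negative for \<open>S t < 1\<close> and \<open>c\<close> is
      nonnegative.\<close>
    have "?q * S t * ln (S t) - n * S t - c * (?q * S t) \<le>
        (\<Sum>i\<in>active xs. w i) * ln (S t) - n * S t - c * (\<Sum>i\<in>active xs. w i)"
      using w(2) S0 elim(2) c_nonneg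
      by (intro diff_mono mult_right_mono_neg mult_left_mono order_refl) auto
    also have "\<dots> = (\<Sum>i\<in>active xs. w i * ln (S t) - S t - c * w i)"
      by (simp add: sum_subtractf sum_distrib_left sum_distrib_right n_def)
    also have "\<dots> \<le> (\<Sum>i\<in>active xs. w i * deriv \<theta> (w i))"
    proof (intro sum_mono)
      fix j assume j: "j \<in> active xs"
      show "w j * ln (S t) - S t - c * w j \<le> w j * deriv \<theta> (w j)"
      proof (cases "w j = 0")
        case False
        then have "0 < w j" "w j < d" using w(1)[of j] w(3)[OF j] elim(1) j by (auto intro: le_less_trans)
        then have "w j * (ln (w j) - c) \<le> w j * deriv \<theta> (w j)" using c by (intro mult_left_mono) auto
        then show ?thesis using mult_ln_ge[OF S0 w(1)[of j]] by (simp add: algebra_simps)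
      qed (use S0 in simp)
    qed
    also note w(4)
    finally have "S t * (?q * ln (S t)) \<le> S t * (C + n + c * ?q - \<gamma> * \<nu>s * real t / 2)"
      by (simp add: algebra_simps)
    then have "?q * ln (S t) \<le> C + n + c * ?q - \<gamma> * \<nu>s * real t / 2" using S0 by simp
    also have "\<dots> \<le> ?q * K - \<gamma> * (?q * ?e) * real t / 2"
    proof -
      have "\<gamma> * (?q * ?e) * real t / 2 \<le> \<gamma> * \<nu>s * real t / 2"
        using eff_sharpness_le \<gamma> by (intro divide_right_mono mult_right_mono mult_left_mono) auto
      then show ?thesis using q by (simp add: K_def)
    qed
    also have "\<dots> = ?q * (K - \<gamma> * ?e * real t / 2)" by (simp add: algebra_simps)
    finally have "ln (S t) \<le> K - \<gamma> * ?e * real t / 2" using q by simp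
    then have "S t \<le> exp (K - \<gamma> * ?e * real t / 2)" using S0 by (metis exp_le_cancel_iff exp_ln)
    then have "x t $ i \<le> exp (K - \<gamma> * ?e * real t / 2)"
      using coord_le_S[OF elim(4) assms(2)] by simp
    moreover have "exp (K - \<gamma> * ?e * real t / 2) = exp K * exp (- \<gamma> * ?e * real t / 2)"
      by (simp add: exp_add[symmetric])
    ultimately show ?case
      using feasible_nonneg[OF bpm_feasible(1)[OF elim(4)], of i] by simp
  qed
  then show ?thesis by (rule bigoI)
qed

text \<open>Here \<open>w j * deriv \<theta> (w j)\<close> is at least a negative multiple of
  \<open>S t powr (1 - p)\<close>. Division by \<open>S t\<close> leaves
  \<open>S t powr (- p)\<close> above a linear function of \<open>t\<close>; the flat weights affect
  only the constant.\<close>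

lemma power_rate:
  assumes "power_like p \<theta>" "i \<in> sharp"
  shows "(\<lambda>t. x t $ i) \<in> O(\<lambda>t. (\<gamma> * eff_sharpness xs \<nu> \<rho> * real t / 2) powr (- 1 / p))"
proof -
  let ?e = "eff_sharpness xs \<nu> \<rho>" and ?q = "1 + real (card flat) * H"
  have ne: "\<not> euclidean_like \<theta>" and p: "0 < p" "p < 1"
    using assms(1) unfolding power_like_def by blast+
  have q: "1 \<le> ?q" using H by simp
  have lim: "- \<infinity> < Liminf (at_right 0) (\<lambda>u. ereal (u powr p * deriv \<theta> u))"
    using assms(1) unfolding power_like_def by blast
  obtain c0 d where d: "0 < d" and c0: "\<And>u. 0 < u \<Longrightarrow> u < d \<Longrightarrow> c0 \<le> u powr p * deriv \<theta> u"
    using Liminf_at_right_0_lower[OF lim] by auto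
  define c where "c = \<bar>c0\<bar> + 1"
  have c: "0 < c" by (simp add: c_def)
  obtain C where C: "eventually (\<lambda>t. \<exists>w. (\<forall>i. 0 \<le> w i \<and> w i \<le> max 1 H * S t) \<and>
      (\<Sum>i\<in>active xs. w i) \<le> ?q * S t \<and> (\<forall>i\<in>active xs. w i \<le> x t $ i) \<and>
      (\<Sum>i\<in>active xs. w i * deriv \<theta> (w i)) \<le> (C - \<gamma> * \<nu>s * real t / 2) * S t) sequentially"
    by (rule weighted_dual_bound[OF ne])
  define n where "n = real (card (active xs))"
  have n: "0 < n" using sharp_nonempty sharp_flat(1) by (auto simp: n_def card_gt_0_iff)
  define K where "K = n * (c * (max 1 H) powr (1 - p))"
  have K: "0 < K" using n c by (simp add: K_def)
  define \<tau> where "\<tau> t = \<gamma> * ?e * real t / 2" for t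
  have "filterlim \<tau> at_top sequentially"
  proof -
    have "\<tau> = (\<lambda>t. (\<gamma> * ?e / 2) * real t)" by (simp add: \<tau>_def fun_eq_iff)
    moreover have "filterlim (\<lambda>t. (\<gamma> * ?e / 2) * real t) at_top sequentially"
      by (rule filterlim_tendsto_pos_mult_at_top[OF tendsto_const _ filterlim_real_sequentially])
        (use \<gamma> eff_sharpness_pos in simp)
    ultimately show ?thesis by (simp only:)
  qed
  \<comment> \<open>This makes \<tau> \<open>t\<close> positive and \<open>C\<close> at most half of
    it.\<close>
  then have "eventually (\<lambda>t. 2 * \<bar>C\<bar> + 1 \<le> \<tau> t) sequentially"
    unfolding filterlim_at_top by blast
  moreover have "eventually (\<lambda>t. \<forall>i\<in>active xs. x t $ i < d) sequentially"
    using order_tendstoD(2)[OF sharp_tendsto] d by (simp add: eventually_ball_finite)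
  ultimately have "eventually (\<lambda>t. norm (x t $ i) \<le> (1 / (2 * K)) powr (- 1 / p) * norm (\<tau> t powr (- 1 / p))) sequentially"
    using C eventually_ge_at_top[of 1]
  proof eventually_elim
    case (elim t)
    then obtain w where w: "\<And>i. 0 \<le> w i" "\<And>i. w i \<le> max 1 H * S t"
      "\<And>i. i \<in> active xs \<Longrightarrow> w i \<le> x t $ i"
      "(\<Sum>i\<in>active xs. w i * deriv \<theta> (w i)) \<le> (C - \<gamma> * \<nu>s * real t / 2) * S t" by blast
    have S0: "0 < S t" using S_pos[OF ne] elim by blast
    have "- (c * (max 1 H * S t) powr (1 - p)) \<le> w j * deriv \<theta> (w j)" if j: "j \<in> active xs" for j
    proof (cases "w j = 0")
      case False
      then have wj: "0 < w j" "w j < d" using w(1)[of j] w(3)[OF j] elim(2) j by (auto intro: le_less_trans)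
      have "- c \<le> w j powr p * deriv \<theta> (w j)" using c0[OF wj] by (simp add: c_def)
      then have "w j powr (1 - p) * (- c) \<le> w j powr (1 - p) * (w j powr p * deriv \<theta> (w j))"
        by (intro mult_left_mono) auto
      also have "\<dots> = w j * deriv \<theta> (w j)"
        using wj by (simp add: mult.assoc[symmetric] powr_add[symmetric])
      finally have "- (c * w j powr (1 - p)) \<le> w j * deriv \<theta> (w j)" by (simp add: mult.commute)
      moreover have "c * w j powr (1 - p) \<le> c * (max 1 H * S t) powr (1 - p)"
        using w(1,2) p c by (intro mult_left_mono powr_mono2) auto
      ultimately show ?thesis by linarith
    qed (use c in simp)
    then have "n * (- (c * (max 1 H * S t) powr (1 - p))) \<le> (\<Sum>j\<in>active xs. w j * deriv \<theta> (w j))"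
      unfolding n_def by (intro sum_bounded_below) auto
    moreover have "n * (- (c * (max 1 H * S t) powr (1 - p))) = - (S t * (K * S t powr (- p)))"
    proof -
      have "S t powr (1 - p) = S t * S t powr (- p)"
        using S0 powr_add[of "S t" 1 "- p"] by simp
      moreover have "(max 1 H * S t) powr (1 - p) = (max 1 H) powr (1 - p) * S t powr (1 - p)"
        by (rule powr_mult)
      ultimately show ?thesis by (simp add: K_def)
    qed
    ultimately have "S t * (\<gamma> * \<nu>s * real t / 2 - C) \<le> S t * (K * S t powr (- p))"
      using w(4) by (simp add: algebra_simps)
    then have "\<gamma> * \<nu>s * real t / 2 - C \<le> K * S t powr (- p)" using S0 by simp
    moreover have "\<tau> t \<le> \<gamma> * \<nu>s * real t / 2"
    proof -
      have "?e \<le> ?q * ?e" using q eff_sharpness_pos by simp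
      then have "?e \<le> \<nu>s" using eff_sharpness_le by linarith
      then show ?thesis unfolding \<tau>_def using \<gamma> by (simp add: mult_left_mono mult_right_mono)
    qed
    ultimately have "\<tau> t / 2 \<le> K * S t powr (- p)" using elim(1) by linarith
    then have le: "1 / (2 * K) * \<tau> t \<le> S t powr (- p)" using K by (simp add: field_simps)
    have \<tau>0: "0 < \<tau> t" using elim(1) by linarith
    have "x t $ i \<le> S t" using coord_le_S[OF elim(4) assms(2)] .
    \<comment> \<open>The exponent \<open>- 1 / p\<close> undoes \<open>- p\<close> and reverses
      order, so the lower bound on the power becomes an upper bound on \<open>S t\<close>.\<close>
    also have "S t = (S t powr (- p)) powr (- 1 / p)" using S0 p by (simp add: powr_powr)
    also have "\<dots> \<le> (1 / (2 * K) * \<tau> t) powr (- 1 / p)"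
      using le K \<tau>0 p by (intro powr_mono2') auto
    also have "\<dots> = (1 / (2 * K)) powr (- 1 / p) * \<tau> t powr (- 1 / p)"
      by (rule powr_mult)
    finally show ?case
      using feasible_nonneg[OF bpm_feasible(1)[OF elim(4)], of i] by simp
  qed
  then show ?thesis unfolding \<tau>_def by (rule bigoI)
qed

end

section \<open>Neighborhoods of the solution and the choice of the initial point\<close>

lemma nhd_in_norm_ball:
  fixes N :: "real^'n \<Rightarrow> real"
  assumes "is_norm N" "nhd_in X p U"
  obtains r where "0 < r" "\<And>x. x \<in> X \<Longrightarrow> N (x - p) < r \<Longrightarrow> x \<in> U"
proof -
  obtain V where V: "open V" "p \<in> V" "V \<inter> X \<subseteq> U" using assms(2) unfolding nhd_in_def by blast
  then obtain e where e: "e > 0" "ball p e \<subseteq> V" using openE by blast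
  obtain c where c: "c > 0" "\<And>x. c * norm x \<le> N x" using is_norm_lower[OF assms(1)] by blast
  have "x \<in> U" if "x \<in> X" "N (x - p) < c * e" for x
  proof -
    have "c * norm (x - p) < c * e" using c(2)[of "x - p"] that(2) by linarith
    then have "x \<in> ball p e" using c(1) by (simp add: dist_norm norm_minus_commute)
    then show ?thesis using e V that by blast
  qed
  then show ?thesis using that[of "c * e"] e c by simp
qed

lemma norm_ball_nhd:
  fixes N :: "real^'n \<Rightarrow> real"
  assumes "is_norm N" "0 < r"
  obtains V where "open V" "p \<in> V" "\<And>x. x \<in> V \<Longrightarrow> N (x - p) < r"
proof -
  obtain C where C: "C > 0" "\<And>x. N x \<le> C * norm x" using is_norm_upper[OF assms(1)] by blast
  have "N (x - p) < r" if "x \<in> ball p (r / C)" for x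
  proof -
    have "C * norm (x - p) < r" using that C by (simp add: dist_norm norm_minus_commute field_simps)
    then show ?thesis using C(2)[of "x - p"] by linarith
  qed
  then show ?thesis using that[of "ball p (r / C)"] C assms(2) by simp
qed

text \<open>Tightness says that the square root of the divergence is at most a multiple of
  \<open>N (x - p) powr \<alpha>\<close> near \<open>p\<close>; since the exponent is below 1,
  \<alpha> is positive and the divergence tends to 0.\<close>

lemma tight_bregman_small:
  fixes N :: "real^'n \<Rightarrow> real"
  assumes N: "is_norm N" and tight: "tight_at N h dh p" "legendre_exponent N h dh p < 1" and e: "0 < e"
  obtains V where "open V" "p \<in> V" "\<And>x. x \<in> V \<Longrightarrow> x \<in> prox_dom h \<Longrightarrow> bregman_div h dh p x \<le> e"
proof -
  define \<alpha> where "\<alpha> = 1 - legendre_exponent N h dh p"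
  have \<alpha>: "0 < \<alpha>" using tight(2) by (simp add: \<alpha>_def)
  let ?f = "\<lambda>x. sqrt (bregman_div h dh p x) / N (x - p) powr \<alpha>"
  have "Limsup (at p within prox_dom h) (\<lambda>x. ereal (?f x)) < \<infinity>"
    using tight(1) unfolding tight_at_def legendre_set_def \<alpha>_def by simp
  then obtain M0 where "Limsup (at p within prox_dom h) (\<lambda>x. ereal (?f x)) < ereal M0"
    by (metis ereal_dense2)
  then have ev: "eventually (\<lambda>x. ereal (?f x) < ereal M0) (at p within prox_dom h)"
    by (rule Limsup_lessD)
  define M where "M = max 1 M0"
  have M: "0 < M" by (simp add: M_def)
  from ev obtain V1 where V1: "open V1" "p \<in> V1"
    "\<And>x. x \<in> V1 \<Longrightarrow> x \<noteq> p \<Longrightarrow> x \<in> prox_dom h \<Longrightarrow> ?f x \<le> M"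
    unfolding eventually_at_topological M_def by (auto simp: max_def) (smt (verit))
  \<comment> \<open>The solution of \<open>M * r powr \<alpha> = sqrt e\<close>.\<close>
  define r where "r = (sqrt e / M) powr (1 / \<alpha>)"
  have r: "0 < r" using e M by (simp add: r_def)
  obtain V2 where V2: "open V2" "p \<in> V2" "\<And>x. x \<in> V2 \<Longrightarrow> N (x - p) < r"
    using norm_ball_nhd[OF N r] by metis
  have "bregman_div h dh p x \<le> e" if x: "x \<in> V1 \<inter> V2" "x \<in> prox_dom h" for x
  proof (cases "x = p")
    \<comment> \<open>The limit superior ignores the point \<open>p\<close> itself, where the
      divergence is 0.\<close>
    case True
    then show ?thesis using e by (simp add: bregman_div_def)
  next
    case False
    then have pos: "0 < N (x - p)"
      using is_normD(6,7)[OF N, of "x - p"] by (simp add: order_less_le)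
    have "N (x - p) powr \<alpha> \<le> r powr \<alpha>" using V2(3)[of x] x pos \<alpha> by (intro powr_mono2) auto
    also have "\<dots> = sqrt e / M" using \<alpha> e M by (simp add: r_def powr_powr)
    finally have "M * N (x - p) powr \<alpha> \<le> sqrt e" using M by (simp add: field_simps)
    moreover have "sqrt (bregman_div h dh p x) \<le> M * N (x - p) powr \<alpha>"
      using V1(3)[of x] x False pos by (simp add: pos_divide_le_eq)
    ultimately have "sqrt (bregman_div h dh p x) \<le> sqrt e" by linarith
    then show ?thesis by simp
  qed
  then show ?thesis using that[of "V1 \<inter> V2"] V1 V2 by blast
qed

theorem theorem2:
  fixes A :: "real^'n^'m" and b :: "real^'m" and xstar :: "real^'n"
  assumes "\<exists>x\<in>feasible A b. \<forall>i. 0 < x $ i"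
    and "xstar \<in> feasible A b"
  shows "\<exists>\<rho>::real. \<rho> \<ge> 1 \<and>
    (\<forall>(N :: real^'n \<Rightarrow> real) (g :: real^'n \<Rightarrow> real^'n) (\<nu> :: 'n \<Rightarrow> real) (L :: real) (\<mu> :: real)
      (B :: (real^'n) set) (h :: real^'n \<Rightarrow> ereal) (dh :: real^'n \<Rightarrow> real^'n)
      (\<theta> :: real \<Rightarrow> real) (p :: real) (la :: real) (lb :: real) (\<gamma> :: real).
      is_norm N \<longrightarrow>
      solves_VI (feasible A b) g xstar \<longrightarrow>
      slackness A g xstar \<nu> \<longrightarrow>
      0 < L \<longrightarrow>
      (\<forall>x\<in>feasible A b. \<forall>x'\<in>feasible A b. dual_norm N (g x' - g x) \<le> L * N (x' - x)) \<longrightarrow>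
      nhd_in (feasible A b) xstar B \<longrightarrow> convex B \<longrightarrow>
      0 < \<mu> \<longrightarrow>
      (\<forall>x\<in>B. (g x - g xstar) \<bullet> (x - xstar) \<ge> \<mu> * (N (x - xstar))\<^sup>2) \<longrightarrow>
      bregman_regularizer N (feasible A b) h dh \<longrightarrow>
      decomposable (feasible A b) h dh \<theta> \<longrightarrow>
      tight_at N h dh xstar \<longrightarrow>
      0 \<le> legendre_exponent N h dh xstar \<longrightarrow> legendre_exponent N h dh xstar < 1 \<longrightarrow>
      (\<exists>U. nhd_in (feasible A b) xstar U \<and> strongly_convex_wrt N 1 h dh U) \<longrightarrow>
      euclidean_like \<theta> \<or> entropy_like \<theta> \<or> power_like p \<theta> \<longrightarrow>
      bpm_params la lb \<longrightarrow>
      0 < \<gamma> \<longrightarrow>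
      \<gamma> \<le> 1 / (2 * ((sqrt 5 + 1) / 2) * L) \<longrightarrow>
      \<gamma> * (1 - la - lb)\<^sup>2 \<le> \<mu> / (8 * L\<^sup>2) \<longrightarrow>
      (\<exists>U1. nhd_in (feasible A b) xstar U1 \<and>
        (\<forall>x xh. bpm (feasible A b) h dh g la lb (\<lambda>_. \<gamma>) x xh \<longrightarrow> x 1 \<in> U1 \<longrightarrow>
          (\<forall>i\<in>sharp_dirs xstar \<nu>.
            (euclidean_like \<theta> \<longrightarrow> (\<exists>T\<ge>1. \<forall>t\<ge>T. x t $ i = 0)) \<and>
            (entropy_like \<theta> \<longrightarrow>
              (\<lambda>t. x t $ i) \<in> O(\<lambda>t. exp (- \<gamma> * eff_sharpness xstar \<nu> \<rho> * real t / 2))) \<and>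
            (power_like p \<theta> \<longrightarrow>
              (\<lambda>t. x t $ i) \<in> O(\<lambda>t. (\<gamma> * eff_sharpness xstar \<nu> \<rho> * real t / 2) powr (- 1 / p)))))))"
proof -
  \<comment> \<open>\<open>H\<close> is fixed before the norm, the operator, the regularizer and the
    step-size are introduced, so the witness for \<rho> depends on \<open>A\<close>,
    \<open>b\<close> and \<open>xstar\<close> only.\<close>
  obtain H where H: "0 < H"
    "\<And>x S. x \<in> feasible A b \<Longrightarrow> (\<forall>i. \<bar>x $ i - xstar $ i\<bar> \<le> 1) \<Longrightarrow> S \<subseteq> active xstar \<Longrightarrow>
      \<exists>y\<in>feasible A b. (\<forall>i\<in>S. y $ i = 0) \<and> norm (x - y) \<le> H * (\<Sum>i\<in>S. x $ i)"
    using face_error_bound[OF assms(2)] by blast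
  show ?thesis
  proof (intro exI[of _ "1 + real CARD('n) * H"] conjI allI impI, goal_cases)
    case 1
    then show ?case using H(1) by simp
  next
    case (2 N g \<nu> L \<mu> B h dh \<theta> p la lb \<gamma>)
    note N = 2(1)
    obtain U where U: "nhd_in (feasible A b) xstar U" "strongly_convex_wrt N 1 h dh U" using 2(15) by blast
    obtain rU where rU: "0 < rU" "\<And>x. x \<in> feasible A b \<Longrightarrow> N (x - xstar) < rU \<Longrightarrow> x \<in> U"
      using nhd_in_norm_ball[OF N U(1)] by metis
    obtain rB where rB: "0 < rB" "\<And>x. x \<in> feasible A b \<Longrightarrow> N (x - xstar) < rB \<Longrightarrow> x \<in> B"
      using nhd_in_norm_ball[OF N 2(6)] by metis
    define r where "r = min rU rB"
    interpret decomposable_regularizer A b N h dh \<theta>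
      by standard (use assms 2 in auto)
    interpret bpm_local A b N h dh \<theta> g xstar L \<mu> la lb \<gamma> r
    proof
      show "0 < r" using rU rB by (simp add: r_def)
      show "\<mu> * (N (x - xstar))\<^sup>2 \<le> (g x - g xstar) \<bullet> (x - xstar)"
        if "x \<in> feasible A b" "N (x - xstar) < r" for x
        using 2(9) rB(2)[of x] that by (simp add: r_def)
      show "(N (p - x))\<^sup>2 / 2 \<le> bregman_div h dh p x"
        if "x \<in> prox_dom h" "p \<in> feasible A b" "N (x - xstar) < r" "N (p - xstar) < r" for x p
        using bregman_strong[OF U(2) that(1) _ _ that(2)] rU(2) that prox_dom_feasible by (simp add: r_def)
    qed (use 2 in auto)
    obtain V1 where V1: "open V1" "xstar \<in> V1" "\<And>x. x \<in> V1 \<Longrightarrow> N (x - xstar) < r"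
      using norm_ball_nhd[OF N r] by metis
    obtain V2 where V2: "open V2" "xstar \<in> V2"
      "\<And>x. x \<in> V2 \<Longrightarrow> x \<in> prox_dom h \<Longrightarrow> bregman_div h dh xstar x \<le> \<epsilon>"
      using tight_bregman_small[OF N 2(12,14) \<epsilon>_pos] by metis
    show ?case
    \<comment> \<open>\<open>V1\<close> puts \<open>x 1\<close> into the ball of radius
      \<open>r\<close>, and \<open>V2\<close> makes its divergence at most \<epsilon>; these are the
      two initial conditions of \<open>bpm_run\<close>.\<close>
    proof (intro exI[of _ "V1 \<inter> V2 \<inter> feasible A b"] conjI allI impI ballI)
      show "nhd_in (feasible A b) xstar (V1 \<inter> V2 \<inter> feasible A b)"
        unfolding nhd_in_def using V1 V2 by (intro conjI exI[of _ "V1 \<inter> V2"]) auto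
      fix x xh i
      assume run: "bpm (feasible A b) h dh g la lb (\<lambda>_. \<gamma>) x xh" "x 1 \<in> V1 \<inter> V2 \<inter> feasible A b"
        and i: "i \<in> sharp_dirs xstar \<nu>"
      have "x 1 \<in> prox_dom h" using run(1) unfolding bpm_def by blast
      then interpret run: bpm_run A b N h dh \<theta> g xstar L \<mu> la lb \<gamma> r x xh
        by unfold_locales (use run V1 V2 in auto)
      interpret rates: bpm_rates A b N h dh \<theta> g xstar L \<mu> la lb \<gamma> r x xh \<nu> H
        by unfold_locales (use 2(3) i H in auto)
      show "\<exists>T\<ge>1. \<forall>t\<ge>T. x t $ i = 0" if euclidean: "euclidean_like \<theta>"
      proof -
        obtain T where "\<And>t. T \<le> t \<Longrightarrow> \<forall>i\<in>sharp_dirs xstar \<nu>. x t $ i = 0"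
          using rates.euclidean_identification[OF euclidean] unfolding eventually_sequentially by blast
        then show ?thesis using i by (intro exI[of _ "max 1 T"]) auto
      qed
      show "(\<lambda>t. x t $ i) \<in> O(\<lambda>t. exp (- \<gamma> * eff_sharpness xstar \<nu> (1 + real CARD('n) * H) * real t / 2))"
        if "entropy_like \<theta>"
        using rates.entropy_rate[OF that i] unfolding rates.\<rho>_def .
      show "(\<lambda>t. x t $ i) \<in> O(\<lambda>t. (\<gamma> * eff_sharpness xstar \<nu> (1 + real CARD('n) * H) * real t / 2) powr (- 1 / p))"
        if "power_like p \<theta>"
        using rates.power_rate[OF that i] unfolding rates.\<rho>_def .
    qed
  qed
qed

end
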